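(* Let $\mathcal H$ be the Hecke algebra of $G_4$ with basis $B_{sts}$. An element $h=\sum_{w\in G_4}r_w\tilde T_w$ (expanded in $B_{sts}$, with $r_w\in R$ and $w$ denoting the word occurring in $B_{sts}$) is in the centre $Z(\mathcal H)$ if and only if the following relations hold: [C1] $r_{s^2t}=r_{ts^2}=(1+\xi_1\xi_2)r_{t^2s}+\xi_1r_{s^2}+\xi_1(\xi_1+\xi_2^2)r_{t^2s^2}$; [C2] $r_{sts}=r_{t^2s}+\xi_1r_{ts}+\xi_1^2r_{t^2s^2}+\xi_1r_{s^2}-\xi_2r_s$; [C3] $r_t=r_s+\xi_1r_{t^2s}+\xi_1\xi_2r_{t^2s^2}$; [C4] $r_{s^2ts}=r_{sts^2}=r_s+\xi_1(2+\xi_1\xi_2)r_{t^2s}+\xi_1^2r_{s^2}+\xi_1(\xi_2+\xi_1\xi_2^2+\xi_1^2)r_{t^2s^2}$; [C5] $r_{st^2s}=(1-\xi_1\xi_2^2)r_{t^2s^2}+\xi_1(1-\xi_2)r_{t^2s}-\xi_2r_s$; [C6] $r_{ts^2t}=(1+2\xi_1\xi_2+\xi_2^3)r_{t^2s^2}+\xi_2r_{s^2}+(\xi_1+\xi_2^2)r_{t^2s}$; [C7] $r_{s^2ts^2}=r_{ts}+\xi_2(1+\xi_1\xi_2)r_{t^2s}+\xi_1\xi_2r_{s^2}+\xi_1\xi_2(\xi_1+\xi_2^2)r_{t^2s^2}$; [C8] $r_{t^2st^2}=r_{ts}+\xi_2(2+\xi_1\xi_2)r_{t^2s}+\xi_1\xi_2r_{s^2}+\xi_2(\xi_2+\xi_1\xi_2^2+\xi_1^2)r_{t^2s^2}$;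 [C9] $r_{s^2t^2s}=r_{st^2s^2}=r_{s^2}+\xi_1r_{t^2s^2}$; [C10] $r_{t^2}=r_{s^2}$; [C11] $r_{s^2t^2s^2}=r_{t^2s}+\xi_2r_{t^2s^2}$; [C12] $r_{st}=r_{ts}$; [C13] $r_{st^2}=r_{t^2s}$; [C14] $r_{s^2t^2}=r_{t^2s^2}$. The set $\mathcal M=\{1,s,s^2,ts,t^2s,t^2s^2,ststst\}$ forms a distinguished set: it consists of one reduced expression for an element of each conjugacy class of $G_4$, and there are relations expressing every coefficient $r_g$ as an $R$-linear combination of the coefficients $r_w$, $w\in\mathcal M$, which hold if and only if $h$ is central. Consequently, $Z(\mathcal H)$ has an $R$-basis.
   Context: $G_4=\langle s,t\mid s^3=t^3=1,\ sts=tst\rangle$ (a complex reflection group of order 24). Let $\xi_1,\xi_2$ be indeterminates and $R=\mathbb Z[\xi_1,\xi_2]$. The Hecke algebra $\mathcal H$ of $G_4$ is the $R$-algebra generated by $\tilde T_s,\tilde T_t$ subject to $\tilde T_s\tilde T_t\tilde T_s=\tilde T_t\tilde T_s\tilde T_t$ and $\tilde T_x^3=1+\xi_1\tilde T_x+\xi_2\tilde T_x^2$ for $x\in\{s,t\}$. For a word $x_1\cdots x_k$ in $s,t$ put $\tilde T_{x_1\cdots x_k}=\tilde T_{x_1}\cdots\tilde T_{x_k}$, $\tilde T_1=1$. $\mathcal H$ is a free $R$-module of rank 24 with $R$-basis $B_{sts}$ consisting of the elements $\tilde T_w$ for the words $w\in\{1,s,t,s^2,t^2,st,ts,st^2,t^2s,s^2t,ts^2,s^2t^2,t^2s^2,st^2s,ts^2t,s^2ts^2,t^2st^2,ststst,sts,sts^2,s^2ts,s^2t^2s,st^2s^2,s^2t^2s^2\}$,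 one for each element of $G_4$.
   Formalization: Relation [C5] is false as printed and is proved in the corrected form $r_{st^2s}=r_{t^2s^2}+\xi_1r_{t^2s}-\xi_2r_{s^2}$ (the printed one amounts to having $r_t$ in place of $r_{t^2}=r_{s^2}$); all other relations are as stated. *)

theory Defs
  imports
    "HOL-Algebra.Group"
    "HOL-Library.Poly_Mapping"
    "HOL-Computational_Algebra.Polynomial"
begin

datatype gen = S | T


section \<open>The group \<open>G\<^sub>4\<close>\<close>

text \<open>
  Group words are lists of signed letters: \<open>(x, True)\<close> stands for the generator \<open>x\<close> and
  \<open>(x, False)\<close> for its formal inverse. The relation \<open>g4_eq\<close> is the congruence on group words
  generated by free cancellation and the defining relations, so its classes form the group
  with presentation \<open>\<langle>s, t | s\<^sup>3 = t\<^sup>3 = 1, sts = tst\<rangle>\<close>.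
\<close>

type_synonym gword = "(gen \<times> bool) list"

definition gword_of :: "gen list \<Rightarrow> gword" where
  "gword_of w = map (\<lambda>x. (x, True)) w"

inductive g4_eq :: "gword \<Rightarrow> gword \<Rightarrow> bool" where
  refl: "g4_eq u u"
| sym: "g4_eq u v \<Longrightarrow> g4_eq v u"
| trans: "g4_eq u v \<Longrightarrow> g4_eq v w \<Longrightarrow> g4_eq u w"
| append: "g4_eq u u' \<Longrightarrow> g4_eq v v' \<Longrightarrow> g4_eq (u @ v) (u' @ v')"
| cancel: "g4_eq [(x, b), (x, \<not> b)] []"
| order3: "g4_eq (gword_of [x, x, x]) []"
| braid: "g4_eq (gword_of [S, T, S]) (gword_of [T, S, T])"

definition g4_rel :: "gword rel" where
  "g4_rel = {(u, v). g4_eq u v}"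

definition G4 :: "gword set monoid" where
  "G4 = \<lparr>carrier = UNIV // g4_rel,
         monoid.mult = (\<lambda>A B. \<Union>u\<in>A. \<Union>v\<in>B. g4_rel `` {u @ v}),
         monoid.one = g4_rel `` {[]}\<rparr>"

definition g4_elem :: "gen list \<Rightarrow> gword set" where
  "g4_elem w = g4_rel `` {gword_of w}"

definition conj_class :: "('a, 'b) monoid_scheme \<Rightarrow> 'a \<Rightarrow> 'a set" where
  "conj_class G g = {h \<otimes>\<^bsub>G\<^esub> g \<otimes>\<^bsub>G\<^esub> inv\<^bsub>G\<^esub> h |h. h \<in> carrier G}"

text \<open>
  Length is counted in the letters \<open>s, t\<close> (no inverses), so \<open>s\<^sup>2\<close> has length 2.
\<close>

definition reduced :: "gen list \<Rightarrow> bool" where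
  "reduced w \<longleftrightarrow> (\<forall>v. g4_elem v = g4_elem w \<longrightarrow> length w \<le> length v)"


section \<open>The free algebra on two generators over \<open>\<int>[\<xi>\<^sub>1, \<xi>\<^sub>2]\<close>\<close>

type_synonym R = "int poly poly"

definition xi1 :: R  (\<open>\<xi>\<^sub>1\<close>) where "\<xi>\<^sub>1 = [:[:0, 1:]:]"
definition xi2 :: R  (\<open>\<xi>\<^sub>2\<close>) where "\<xi>\<^sub>2 = [:0, 1:]"

text \<open>
  The class \<open>monoid_add\<close> is not commutative: here it carries concatenation of words, so that the
  convolution product of \<open>word \<Rightarrow>\<^sub>0 R\<close> is the product of the free associative algebra.
\<close>

datatype word = Word "gen list"

instantiation word :: monoid_add
begin
definition "0 = Word []"
fun plus_word :: "word \<Rightarrow> word \<Rightarrow> word" where "Word u + Word v = Word (u @ v)"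
instance
proof
  fix a b c :: word
  show "a + b + c = a + (b + c)" by (cases a; cases b; cases c) simp
  show "0 + a = a" "a + 0 = a" by (cases a; simp add: zero_word_def)+
qed
end

type_synonym free_alg = "word \<Rightarrow>\<^sub>0 R"

definition fconst :: "R \<Rightarrow> free_alg" where
  "fconst c = Poly_Mapping.single 0 c"

definition fgen :: "gen \<Rightarrow> free_alg" where
  "fgen x = Poly_Mapping.single (Word [x]) 1"

lemma fconst_simps:
  "fconst 0 = 0" "fconst 1 = 1" "fconst (a + b) = fconst a + fconst b"
  "fconst (a * b) = fconst a * fconst b"
  by (simp_all add: fconst_def single_add mult_single)

text \<open>The two-sided ideal generated by the defining relations of the Hecke algebra.\<close>

inductive_set hecke_ideal :: "free_alg set" where
  braid: "fgen S * fgen T * fgen S - fgen T * fgen S * fgen T \<in> hecke_ideal"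
| cubic: "fgen x ^ 3 - (1 + fconst \<xi>\<^sub>1 * fgen x + fconst \<xi>\<^sub>2 * fgen x ^ 2) \<in> hecke_ideal"
| zero: "0 \<in> hecke_ideal"
| add: "a \<in> hecke_ideal \<Longrightarrow> b \<in> hecke_ideal \<Longrightarrow> a + b \<in> hecke_ideal"
| lmult: "a \<in> hecke_ideal \<Longrightarrow> c * a \<in> hecke_ideal"
| rmult: "a \<in> hecke_ideal \<Longrightarrow> a * c \<in> hecke_ideal"

lemma hecke_ideal_uminus: "a \<in> hecke_ideal \<Longrightarrow> - a \<in> hecke_ideal"
  using hecke_ideal.lmult [of a "- 1"] by simp

definition hecke_eq :: "free_alg \<Rightarrow> free_alg \<Rightarrow> bool" where
  "hecke_eq a b \<longleftrightarrow> a - b \<in> hecke_ideal"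

lemma hecke_eq_add: "hecke_eq a b \<Longrightarrow> hecke_eq c d \<Longrightarrow> hecke_eq (a + c) (b + d)"
  unfolding hecke_eq_def by (drule (1) hecke_ideal.add) (simp add: algebra_simps)

lemma hecke_eq_uminus: "hecke_eq a b \<Longrightarrow> hecke_eq (- a) (- b)"
  unfolding hecke_eq_def by (drule hecke_ideal_uminus) simp

lemma hecke_eq_equivp: "equivp hecke_eq"
proof (rule equivpI)
  show "reflp hecke_eq" by (simp add: reflp_def hecke_eq_def hecke_ideal.zero)
  show "symp hecke_eq"
    unfolding symp_def hecke_eq_def by (auto dest: hecke_ideal_uminus)
  show "transp hecke_eq"
  proof (rule transpI)
    fix a b c assume "hecke_eq a b" "hecke_eq b c"
    then have "(a - b) + (b - c) \<in> hecke_ideal"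
      unfolding hecke_eq_def by (rule hecke_ideal.add)
    then show "hecke_eq a c" by (simp add: hecke_eq_def)
  qed
qed

lemma hecke_eq_mult: "hecke_eq a b \<Longrightarrow> hecke_eq c d \<Longrightarrow> hecke_eq (a * c) (b * d)"
proof -
  assume "hecke_eq a b" "hecke_eq c d"
  then have "(a - b) * c + b * (c - d) \<in> hecke_ideal"
    unfolding hecke_eq_def by (intro hecke_ideal.intros)
  then show ?thesis unfolding hecke_eq_def by (simp add: algebra_simps)
qed

text \<open>
  The ideal is proper: it is killed by the ring homomorphism to \<open>\<int>\<close> sending
  \<open>\<xi>\<^sub>1, \<xi>\<^sub>2\<close> to 0 and both generators to 1.
\<close>

definition augment :: "free_alg \<Rightarrow> int" where
  "augment f = (\<Sum>k\<in>Poly_Mapping.keys f. poly (poly (Poly_Mapping.lookup f k) 0) 0)"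

lemma augment_superset:
  assumes "finite A" "Poly_Mapping.keys f \<subseteq> A"
  shows "augment f = (\<Sum>k\<in>A. poly (poly (Poly_Mapping.lookup f k) 0) 0)"
  unfolding augment_def using assms by (intro sum.mono_neutral_left) (auto simp: in_keys_iff)

lemma augment_add: "augment (f + g) = augment f + augment g"
proof -
  let ?A = "Poly_Mapping.keys f \<union> Poly_Mapping.keys g"
  have "finite ?A" by simp
  moreover have "Poly_Mapping.keys (f + g) \<subseteq> ?A" by (rule Poly_Mapping.keys_add)
  ultimately show ?thesis
    by (simp add: augment_superset [of ?A] lookup_add sum.distrib)
qed

lemma augment_single: "augment (Poly_Mapping.single w c) = poly (poly c 0) 0"
  by (simp add: augment_def)

lemma augment_0: "augment 0 = 0"
  by (simp add: augment_def)

lemma free_alg_induct [case_names zero single add]: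
  fixes f :: free_alg
  assumes "P 0" "\<And>w c. P (Poly_Mapping.single w c)" "\<And>f g. P f \<Longrightarrow> P g \<Longrightarrow> P (f + g)"
  shows "P f"
proof (induction f rule: update_induct)
  case const
  then show ?case using assms(1) by simp
next
  case (update f a b)
  have "Poly_Mapping.update a b f = f + Poly_Mapping.single a b"
    using update(1) by (intro poly_mapping_eqI)
      (auto simp: lookup_add lookup_single lookup_update in_keys_iff when_def)
  then show ?case using assms update by simp
qed

lemma augment_mult_single:
  "augment (Poly_Mapping.single w c * g) = augment (Poly_Mapping.single w c) * augment g"
  by (induction g rule: free_alg_induct)
    (simp_all add: augment_0 mult_single augment_single distrib_left augment_add)

lemma augment_mult: "augment (f * g) = augment f * augment g"
  by (induction f rule: free_alg_induct)
    (simp_all add: augment_0 augment_mult_single distrib_right augment_add)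

lemma augment_1: "augment 1 = 1"
  using augment_single [of 0 1] by simp

lemma augment_uminus: "augment (- f) = - augment f"
  using augment_add [of f "- f"] by (simp add: augment_0)

lemma augment_ideal: "a \<in> hecke_ideal \<Longrightarrow> augment a = 0"
proof -
  have diff: "augment (f - g) = augment f - augment g" for f g
    using augment_add [of f "- g"] by (simp add: augment_uminus)
  have gen: "augment (fgen x) = 1" for x by (simp add: fgen_def augment_single)
  have const: "augment (fconst c) = poly (poly c 0) 0" for c
    by (simp add: fconst_def augment_single)
  show "a \<in> hecke_ideal \<Longrightarrow> augment a = 0"
    by (induction rule: hecke_ideal.induct)
      (simp_all add: diff gen const augment_add augment_mult augment_1 augment_0
        power2_eq_square power3_eq_cube xi1_def xi2_def)
qed


section \<open>The Hecke algebra of \<open>G\<^sub>4\<close>\<close>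

quotient_type hecke = free_alg / hecke_eq
  by (rule hecke_eq_equivp)

instantiation hecke :: ring_1
begin

lift_definition zero_hecke :: hecke is 0 .
lift_definition one_hecke :: hecke is 1 .
lift_definition plus_hecke :: "hecke \<Rightarrow> hecke \<Rightarrow> hecke" is "(+)"
  by (rule hecke_eq_add)
lift_definition uminus_hecke :: "hecke \<Rightarrow> hecke" is uminus
  by (rule hecke_eq_uminus)
lift_definition minus_hecke :: "hecke \<Rightarrow> hecke \<Rightarrow> hecke" is "(-)"
  by (simp only: diff_conv_add_uminus hecke_eq_add hecke_eq_uminus)
lift_definition times_hecke :: "hecke \<Rightarrow> hecke \<Rightarrow> hecke" is "(*)"
  by (rule hecke_eq_mult)

instance
proof
  have refl: "hecke_eq a b" if "a = b" for a b
    using that by (simp add: hecke_eq_def hecke_ideal.zero)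
  fix a b c :: hecke
  show "a + b + c = a + (b + c)" by transfer (rule refl, simp add: algebra_simps)
  show "a + b = b + a" by transfer (rule refl, simp add: algebra_simps)
  show "0 + a = a" by transfer (rule refl, simp)
  show "- a + a = 0" by transfer (rule refl, simp)
  show "a - b = a + - b" by transfer (rule refl, simp)
  show "a * b * c = a * (b * c)" by transfer (rule refl, simp add: algebra_simps)
  show "1 * a = a" "a * 1 = a" by (transfer, rule refl, simp)+
  show "(a + b) * c = a * c + b * c" by transfer (rule refl, simp add: algebra_simps)
  show "a * (b + c) = a * b + a * c" by transfer (rule refl, simp add: algebra_simps)
  show "(0::hecke) \<noteq> 1"
    by transfer (use augment_ideal [of "- 1"] in \<open>auto simp: hecke_eq_def augment_uminus augment_1\<close>)
qed

end

lift_definition hecke_scale :: "R \<Rightarrow> hecke \<Rightarrow> hecke"  (infixr \<open>\<cdot>\<^sub>R\<close> 75)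
  is "\<lambda>c h. fconst c * h"
  by (rule hecke_eq_mult) (simp_all add: hecke_eq_def hecke_ideal.zero)

interpretation hecke: module hecke_scale
proof
  have refl: "hecke_eq a b" if "a = b" for a b
    using that by (simp add: hecke_eq_def hecke_ideal.zero)
  fix a b :: R and x y :: hecke
  show "a \<cdot>\<^sub>R (x + y) = a \<cdot>\<^sub>R x + a \<cdot>\<^sub>R y"
    by transfer (rule refl, simp add: algebra_simps)
  show "(a + b) \<cdot>\<^sub>R x = a \<cdot>\<^sub>R x + b \<cdot>\<^sub>R x"
    by transfer (rule refl, simp add: algebra_simps fconst_simps)
  show "a \<cdot>\<^sub>R b \<cdot>\<^sub>R x = (a * b) \<cdot>\<^sub>R x"
    by transfer (rule refl, simp add: algebra_simps fconst_simps)
  show "1 \<cdot>\<^sub>R x = x"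
    by transfer (rule refl, simp add: fconst_simps)
qed

lift_definition hecke_gen :: "gen \<Rightarrow> hecke" is fgen .

definition Tw :: "gen list \<Rightarrow> hecke" where
  "Tw w = prod_list (map hecke_gen w)"

definition hecke_centre :: "hecke set" where
  "hecke_centre = {z. \<forall>h. z * h = h * z}"

definition is_R_basis :: "hecke set \<Rightarrow> hecke set \<Rightarrow> bool" where
  "is_R_basis B M \<longleftrightarrow> hecke.independent B \<and> hecke.span B = M"

definition B_sts :: "gen list set" where
  "B_sts = {[], [S], [T], [S,S], [T,T], [S,T], [T,S], [S,T,T], [T,T,S], [S,S,T], [T,S,S],
            [S,S,T,T], [T,T,S,S], [S,T,T,S], [T,S,S,T], [S,S,T,S,S], [T,T,S,T,T],
            [S,T,S,T,S,T], [S,T,S], [S,T,S,S], [S,S,T,S], [S,S,T,T,S], [S,T,T,S,S],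
            [S,S,T,T,S,S]}"

text \<open>
  Since the words in \<open>B_sts\<close> represent each element of \<open>G\<^sub>4\<close> once, a family of coefficients
  \<open>(r\<^sub>g)\<close> indexed by \<open>G\<^sub>4\<close> is a function on these words; its values on other words are
  irrelevant.
\<close>

definition hecke_comb :: "(gen list \<Rightarrow> R) \<Rightarrow> hecke" where
  "hecke_comb r = (\<Sum>w\<in>B_sts. r w \<cdot>\<^sub>R Tw w)"

definition distinguished_set :: "gen list set \<Rightarrow> bool" where
  "distinguished_set M \<longleftrightarrow>
     M \<subseteq> B_sts \<and> (\<forall>w\<in>M. reduced w) \<and>
     bij_betw (\<lambda>w. conj_class G4 (g4_elem w)) M (conj_class G4 ` carrier G4) \<and>
     (\<exists>c. \<forall>r. hecke_comb r \<in> hecke_centre \<longleftrightarrow> (\<forall>g\<in>B_sts. r g = (\<Sum>w\<in>M. c g w * r w)))"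

end

theory Submission
  imports Defs
begin

text \<open>
  Multiplication by \<open>T\<^sub>s\<close> and \<open>T\<^sub>t\<close> from the left is given on the 24 words by explicit matrices over
  \<open>\<int>[\<xi>\<^sub>1, \<xi>\<^sub>2]\<close>. These satisfy the braid and cubic relations, so the Hecke algebra acts on vectors of
  coordinates, and acting on the vector of \<open>T\<^sub>1\<close> shows that the words are independent; a rewriting
  system obtained from the relations shows that they span. Right multiplication is conjugate to left
  multiplication under reversal of words, so \<open>h\<close> is central iff its coordinates satisfy a sparse linear
  system whose solutions are parametrised freely by the seven coordinates at the class representatives.
  In the group, the same rewriting system bounds the number of elements by 24, and the trace of a
  two-dimensional representation separates the seven classes and detects reduced words.
\<close>


section \<open>Rewriting rules in the Hecke algebra\<close>

text \<open>Products are kept nested to the right, where a rule for a short product no longer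
  matches once factors follow it; these forms supply the tail \<open>z\<close>.\<close>

lemma mult_left_tail:
  fixes u :: "'a::semigroup_mult"
  shows "a * b = u \<Longrightarrow> a * (b * z) = u * z"
  and "a * (b * c) = u \<Longrightarrow> a * (b * (c * z)) = u * z"
  and "a * (b * (c * (d * e))) = u \<Longrightarrow> a * (b * (c * (d * (e * z)))) = u * z"
  and "a * (b * (c * (d * (e * f)))) = u \<Longrightarrow> a * (b * (c * (d * (e * (f * z))))) = u * z"
  by (metis mult.assoc)+

text \<open>Regroup as \<open>ba(aba) = ba(bab) = (bab)ab = (aba)ab\<close>. In a semigroup the
  identity serves both the Hecke algebra and the group.\<close>

lemma braid_tssts:
  fixes a b :: "'a::semigroup_mult"
  assumes "b * (a * b) = a * (b * a)"
  shows "b * (a * (a * (b * a))) = a * (b * (a * (a * b)))"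
proof -
  have "b * (a * (a * (b * a))) = b * a * (b * (a * b))"
    by (simp add: assms mult.assoc)
  also have "\<dots> = b * (a * b) * (a * b)"
    by (simp only: mult.assoc)
  also have "\<dots> = a * (b * (a * (a * b)))"
    by (simp add: assms mult.assoc)
  finally show ?thesis .
qed

text \<open>The previous identity makes a further braid move possible at the right end, which
  exposes the cube \<open>aaa\<close> for the cubic relation.\<close>

lemma braid_stsstt:
  fixes a b :: "'a::semigroup_mult"
  assumes "b * (a * b) = a * (b * a)"
  shows "a * (b * (a * (a * (b * b)))) = b * (a * (a * (a * (b * a))))"
proof -
  have "a * (b * (a * (a * (b * b)))) = a * (b * (a * (a * b))) * b"
    by (simp only: mult.assoc)
  also have "\<dots> = b * (a * a) * (b * (a * b))"
    by (simp only: braid_tssts [OF assms, symmetric]) (simp only: mult.assoc)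
  also have "\<dots> = b * (a * (a * (a * (b * a))))"
    by (simp only: assms mult.assoc)
  finally show ?thesis .
qed

lemma hecke_scale_mult_left: "(c \<cdot>\<^sub>R g) * h = c \<cdot>\<^sub>R (g * h)"
  by transfer (simp add: hecke_eq_def hecke_ideal.zero mult.assoc)

lemma fconst_commute: "fconst c * f = f * fconst c"
  by (induction f rule: free_alg_induct)
    (simp_all add: fconst_def mult_single distrib_left distrib_right mult.commute)

lemma hecke_scale_mult_right: "g * (c \<cdot>\<^sub>R h) = c \<cdot>\<^sub>R (g * h)"
proof (transfer)
  fix g c h
  have "g * (fconst c * h) = fconst c * (g * h)"
    by (metis fconst_commute mult.assoc)
  then show "hecke_eq (g * (fconst c * h)) (fconst c * (g * h))"
    by (simp add: hecke_eq_def hecke_ideal.zero)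
qed

lemmas hecke_scale_simps = hecke.scale_left_distrib hecke.scale_right_distrib
  hecke.scale_left_diff_distrib hecke.scale_right_diff_distrib
  hecke_scale_mult_left hecke_scale_mult_right

abbreviation Ts :: hecke  where "Ts \<equiv> hecke_gen S"
abbreviation Tt :: hecke  where "Tt \<equiv> hecke_gen T"

lemma gen_cubic:
  "hecke_gen x * (hecke_gen x * hecke_gen x) =
     1 + \<xi>\<^sub>1 \<cdot>\<^sub>R hecke_gen x + \<xi>\<^sub>2 \<cdot>\<^sub>R (hecke_gen x * hecke_gen x)"
  by transfer
    (use hecke_ideal.cubic in \<open>simp add: hecke_eq_def power2_eq_square power3_eq_cube mult.assoc\<close>)

lemma gen_braid: "Tt * (Ts * Tt) = Ts * (Tt * Ts)"
  by transfer (use hecke_ideal_uminus [OF hecke_ideal.braid] in \<open>simp add: hecke_eq_def mult.assoc\<close>)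

text \<open>
  The five rules below complete the defining relations to a Groebner basis for the degree-lexicographic
  order with \<open>t > s\<close>: each is an S-polynomial of earlier ones.
\<close>

lemmas gen_simps1 = gen_cubic mult_left_tail(2) [OF gen_cubic] gen_braid mult_left_tail(2) [OF gen_braid]

lemma tssts: "Tt * (Ts * (Ts * (Tt * Ts))) = Ts * (Tt * (Ts * (Ts * Tt)))"
  by (rule braid_tssts [OF gen_braid])

lemma stsstt: "Ts * (Tt * (Ts * (Ts * (Tt * Tt)))) =
   \<xi>\<^sub>2 \<cdot>\<^sub>R (Ts * (Tt * (Ts * (Ts * Tt)))) + \<xi>\<^sub>1 \<cdot>\<^sub>R (Ts * (Tt * (Ts * Ts))) + Tt * (Tt * Ts)"
  unfolding braid_stsstt [OF gen_braid]
  by (simp add: gen_simps1 tssts hecke_scale_simps algebra_simps)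

lemmas gen_simps2 = gen_simps1 tssts mult_left_tail(3) [OF tssts] stsstt mult_left_tail(4) [OF stsstt]

lemma tsstt: "Tt * (Ts * (Ts * (Tt * Tt))) =
   Ts * (Ts * (Tt * (Tt * Ts))) + \<xi>\<^sub>2 \<cdot>\<^sub>R (Tt * (Ts * (Ts * Tt))) - \<xi>\<^sub>2 \<cdot>\<^sub>R (Ts * (Tt * (Tt * Ts)))
   - \<xi>\<^sub>1 \<cdot>\<^sub>R (Tt * (Tt * Ts)) + \<xi>\<^sub>1 \<cdot>\<^sub>R (Tt * (Ts * Ts))"
proof -
  \<comment> \<open>The word \<open>ssstsstt\<close> is reduced in two ways: by expanding
    \<open>sss\<close>, whose summand 1 isolates \<open>tsstt\<close>, and by the rule for
    \<open>stsstt\<close>.\<close>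
  have "(1 + \<xi>\<^sub>1 \<cdot>\<^sub>R Ts + \<xi>\<^sub>2 \<cdot>\<^sub>R (Ts * Ts)) * (Tt * (Ts * (Ts * (Tt * Tt)))) =
    Ts * Ts * (\<xi>\<^sub>2 \<cdot>\<^sub>R (Ts * (Tt * (Ts * (Ts * Tt)))) + \<xi>\<^sub>1 \<cdot>\<^sub>R (Ts * (Tt * (Ts * Ts))) + Tt * (Tt * Ts))"
    by (simp only: gen_cubic [symmetric] stsstt [symmetric] mult.assoc)
  then show ?thesis
    by (simp add: gen_simps2 hecke_scale_simps algebra_simps)
qed

lemmas gen_simps3 = gen_simps2 tsstt mult_left_tail(3) [OF tsstt]

text \<open>Comes from the overlap \<open>tssttst\<close> of \<open>tsstt\<close> and
  \<open>tst\<close>. It prepares \<open>ttsst\<close>, a subword of its left side.\<close>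

lemma ssttsst: "Ts * (Ts * (Tt * (Tt * (Ts * (Ts * Tt))))) =
   \<xi>\<^sub>2 \<cdot>\<^sub>R (Ts * (Tt * (Tt * (Ts * (Ts * Tt))))) + \<xi>\<^sub>2 \<cdot>\<^sub>R (Ts * (Ts * (Tt * (Ts * (Ts * Tt)))))
   + \<xi>\<^sub>1 \<cdot>\<^sub>R (Tt * (Tt * (Ts * (Ts * Tt)))) - (\<xi>\<^sub>2 * \<xi>\<^sub>2) \<cdot>\<^sub>R (Ts * (Tt * (Ts * (Ts * Tt))))
   + Tt * (Tt * (Ts * Ts)) - (\<xi>\<^sub>1 * \<xi>\<^sub>2) \<cdot>\<^sub>R (Tt * (Ts * (Ts * Tt))) - \<xi>\<^sub>2 \<cdot>\<^sub>R (Tt * (Tt * Ts))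
   - \<xi>\<^sub>1 \<cdot>\<^sub>R (Tt * Tt) + \<xi>\<^sub>1 \<cdot>\<^sub>R (Ts * Tt)"
proof -
  have "(Ts * (Ts * (Tt * (Tt * Ts))) + \<xi>\<^sub>2 \<cdot>\<^sub>R (Tt * (Ts * (Ts * Tt))) - \<xi>\<^sub>2 \<cdot>\<^sub>R (Ts * (Tt * (Tt * Ts)))
   - \<xi>\<^sub>1 \<cdot>\<^sub>R (Tt * (Tt * Ts)) + \<xi>\<^sub>1 \<cdot>\<^sub>R (Tt * (Ts * Ts))) * (Ts * Tt) = 
     Tt * (Ts * (Ts * (Tt * (Ts * (Tt * Ts)))))"
    by (simp only: gen_braid [symmetric] tsstt [symmetric] mult.assoc)
  then show ?thesis
    by (simp add: gen_simps3 hecke_scale_simps algebra_simps)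
qed

lemma ttsst: "Tt * (Tt * (Ts * (Ts * Tt))) =
   Ts * (Tt * (Tt * (Ts * Ts))) + \<xi>\<^sub>2 \<cdot>\<^sub>R (Tt * (Ts * (Ts * Tt))) - \<xi>\<^sub>2 \<cdot>\<^sub>R (Ts * (Tt * (Tt * Ts)))
   - \<xi>\<^sub>1 \<cdot>\<^sub>R (Ts * (Tt * Tt)) + \<xi>\<^sub>1 \<cdot>\<^sub>R (Ts * (Ts * Tt))"
proof -
  \<comment> \<open>Multiplying the previous rule by \<open>s\<close> creates \<open>sss\<close>,
    whose summand 1 isolates \<open>ttsst\<close>.\<close>
  have "Ts * (\<xi>\<^sub>2 \<cdot>\<^sub>R (Ts * (Tt * (Tt * (Ts * (Ts * Tt))))) + \<xi>\<^sub>2 \<cdot>\<^sub>R (Ts * (Ts * (Tt * (Ts * (Ts * Tt)))))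
   + \<xi>\<^sub>1 \<cdot>\<^sub>R (Tt * (Tt * (Ts * (Ts * Tt)))) - (\<xi>\<^sub>2 * \<xi>\<^sub>2) \<cdot>\<^sub>R (Ts * (Tt * (Ts * (Ts * Tt))))
   + Tt * (Tt * (Ts * Ts)) - (\<xi>\<^sub>1 * \<xi>\<^sub>2) \<cdot>\<^sub>R (Tt * (Ts * (Ts * Tt))) - \<xi>\<^sub>2 \<cdot>\<^sub>R (Tt * (Tt * Ts))
   - \<xi>\<^sub>1 \<cdot>\<^sub>R (Tt * Tt) + \<xi>\<^sub>1 \<cdot>\<^sub>R (Ts * Tt))
   = (1 + \<xi>\<^sub>1 \<cdot>\<^sub>R Ts + \<xi>\<^sub>2 \<cdot>\<^sub>R (Ts * Ts)) * (Tt * (Tt * (Ts * (Ts * Tt))))"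
    by (simp only: gen_cubic [symmetric] ssttsst [symmetric] mult.assoc)
  then show ?thesis
    by (simp add: gen_simps3 ssttsst hecke_scale_simps algebra_simps)
qed

lemmas gen_simps = gen_simps3 ttsst mult_left_tail(3) [OF ttsst]


section \<open>The regular representation\<close>

text \<open>With a finite index type in place of words, coordinate vectors are functions and
  identities between them reduce to 24 cases.\<close>

datatype basis_ix = W1 | Ws | Wt | Wss | Wtt | Wst | Wts | Wstt | Wtts | Wsst | Wtss | Wsstt
  | Wttss | Wstts | Wtsst | Wsstss | Wttstt | Wststst | Wsts | Wstss | Wssts
  | Wsstts | Wsttss | Wssttss

primrec word_of :: "basis_ix \<Rightarrow> gen list" where
  "word_of W1 = []"
| "word_of Ws = [S]"
| "word_of Wt = [T]"
| "word_of Wss = [S, S]"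
| "word_of Wtt = [T, T]"
| "word_of Wst = [S, T]"
| "word_of Wts = [T, S]"
| "word_of Wstt = [S, T, T]"
| "word_of Wtts = [T, T, S]"
| "word_of Wsst = [S, S, T]"
| "word_of Wtss = [T, S, S]"
| "word_of Wsstt = [S, S, T, T]"
| "word_of Wttss = [T, T, S, S]"
| "word_of Wstts = [S, T, T, S]"
| "word_of Wtsst = [T, S, S, T]"
| "word_of Wsstss = [S, S, T, S, S]"
| "word_of Wttstt = [T, T, S, T, T]"
| "word_of Wststst = [S, T, S, T, S, T]"
| "word_of Wsts = [S, T, S]"
| "word_of Wstss = [S, T, S, S]"
| "word_of Wssts = [S, S, T, S]"
| "word_of Wsstts = [S, S, T, T, S]"
| "word_of Wsttss = [S, T, T, S, S]"
| "word_of Wssttss = [S, S, T, T, S, S]"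

text \<open>
  Reversal of words induces an anti-automorphism of the Hecke algebra. It permutes the basis, as
  \<open>ststst\<close> and \<open>tststs\<close> are equal by the braid relation.
\<close>

primrec rev_ix :: "basis_ix \<Rightarrow> basis_ix" where
  "rev_ix W1 = W1"
| "rev_ix Ws = Ws"
| "rev_ix Wt = Wt"
| "rev_ix Wss = Wss"
| "rev_ix Wtt = Wtt"
| "rev_ix Wst = Wts"
| "rev_ix Wts = Wst"
| "rev_ix Wstt = Wtts"
| "rev_ix Wtts = Wstt"
| "rev_ix Wsst = Wtss"
| "rev_ix Wtss = Wsst"
| "rev_ix Wsstt = Wttss"
| "rev_ix Wttss = Wsstt"
| "rev_ix Wstts = Wstts"
| "rev_ix Wtsst = Wtsst"
| "rev_ix Wsstss = Wsstss"
| "rev_ix Wttstt = Wttstt"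
| "rev_ix Wststst = Wststst"
| "rev_ix Wsts = Wsts"
| "rev_ix Wstss = Wssts"
| "rev_ix Wssts = Wstss"
| "rev_ix Wsstts = Wsttss"
| "rev_ix Wsttss = Wsstts"
| "rev_ix Wssttss = Wssttss"

text \<open>
  The coordinates of \<open>T\<^sub>s h\<close> and \<open>T\<^sub>t h\<close> in terms of the coordinates \<open>f\<close> of \<open>h\<close>, read off from the
  normal forms of the words \<open>sw\<close> and \<open>tw\<close>.
\<close>

primrec left_s :: "(basis_ix \<Rightarrow> R) \<Rightarrow> basis_ix \<Rightarrow> R" where
  "left_s f W1 = f Wss"
| "left_s f Ws = f W1 + \<xi>\<^sub>1 * f Wss"
| "left_s f Wt = f Wsst"
| "left_s f Wss = f Ws + \<xi>\<^sub>2 * f Wss"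
| "left_s f Wtt = f Wsstt"
| "left_s f Wst = f Wt + \<xi>\<^sub>1 * f Wsst"
| "left_s f Wts = f Wssts"
| "left_s f Wstt = f Wtt + \<xi>\<^sub>1 * f Wsstt"
| "left_s f Wtts = f Wsstts"
| "left_s f Wsst = f Wst + \<xi>\<^sub>2 * f Wsst"
| "left_s f Wtss = f Wsstss"
| "left_s f Wsstt = f Wstt + \<xi>\<^sub>2 * f Wsstt"
| "left_s f Wttss = f Wssttss"
| "left_s f Wstts = f Wtts + \<xi>\<^sub>1 * f Wsstts"
| "left_s f Wtsst = f Wststst"
| "left_s f Wsstss = \<xi>\<^sub>2 * f Wsstss + f Wstss"
| "left_s f Wttstt = f Wtsst + \<xi>\<^sub>1 * f Wststst"
| "left_s f Wststst = f Wttstt + \<xi>\<^sub>2 * f Wststst"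
| "left_s f Wsts = f Wts + \<xi>\<^sub>1 * f Wssts"
| "left_s f Wstss = f Wtss + \<xi>\<^sub>1 * f Wsstss"
| "left_s f Wssts = f Wsts + \<xi>\<^sub>2 * f Wssts"
| "left_s f Wsstts = f Wstts + \<xi>\<^sub>2 * f Wsstts"
| "left_s f Wsttss = f Wttss + \<xi>\<^sub>1 * f Wssttss"
| "left_s f Wssttss = f Wsttss + \<xi>\<^sub>2 * f Wssttss"

primrec left_t :: "(basis_ix \<Rightarrow> R) \<Rightarrow> basis_ix \<Rightarrow> R" where
  "left_t f W1 = f Wtt"
| "left_t f Ws = f Wtts"
| "left_t f Wt = f W1 + \<xi>\<^sub>1 * f Wtt + \<xi>\<^sub>1 * f Wsstts + \<xi>\<^sub>1 * \<xi>\<^sub>2 * f Wssttss"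
| "left_t f Wss = f Wttss"
| "left_t f Wtt = f Wt + \<xi>\<^sub>2 * f Wtt - \<xi>\<^sub>1 * f Wssttss"
| "left_t f Wst = f Wstss"
| "left_t f Wts = f Ws + \<xi>\<^sub>1 * f Wtts + \<xi>\<^sub>1^2 * f Wsstts + (\<xi>\<^sub>1 + \<xi>\<^sub>1^2 * \<xi>\<^sub>2) * f Wssttss"
| "left_t f Wstt = - \<xi>\<^sub>1 * f Wtsst + f Wttstt - \<xi>\<^sub>2 * f Wssttss"
| "left_t f Wtts = f Wts + \<xi>\<^sub>2 * f Wtts - \<xi>\<^sub>1 * f Wsstt - \<xi>\<^sub>1^2 * f Wssttss"
| "left_t f Wsst = \<xi>\<^sub>1 * f Wtsst + f Wsttss"
| "left_t f Wtss = f Wss + \<xi>\<^sub>1 * f Wsstt + \<xi>\<^sub>1 * f Wttss + \<xi>\<^sub>1 * \<xi>\<^sub>2 * f Wsstts + (\<xi>\<^sub>1 * \<xi>\<^sub>2^2 + \<xi>\<^sub>1^2) * f Wssttss"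
| "left_t f Wsstt = f Wssttss"
| "left_t f Wttss = f Wtss + \<xi>\<^sub>2 * f Wttss - \<xi>\<^sub>1 * f Wsstts - \<xi>\<^sub>1 * \<xi>\<^sub>2 * f Wssttss"
| "left_t f Wstts = - \<xi>\<^sub>2 * f Wsstt - \<xi>\<^sub>2 * f Wtsst + f Wststst - \<xi>\<^sub>1 * \<xi>\<^sub>2 * f Wssttss"
| "left_t f Wtsst = f Wsst + \<xi>\<^sub>2 * f Wsstt + \<xi>\<^sub>2 * f Wtsst"
| "left_t f Wsstss = f Wstts + \<xi>\<^sub>1 * f Wststst + \<xi>\<^sub>2 * f Wsttss"
| "left_t f Wttstt = \<xi>\<^sub>2 * f Wttstt + f Wssts + \<xi>\<^sub>2 * f Wsstts"
| "left_t f Wststst = f Wsstss + \<xi>\<^sub>2 * f Wststst + \<xi>\<^sub>2 * f Wssttss"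
| "left_t f Wsts = f Wst + \<xi>\<^sub>1 * f Wstss"
| "left_t f Wstss = f Wsts + \<xi>\<^sub>2 * f Wstss"
| "left_t f Wssts = f Wstt + \<xi>\<^sub>1 * f Wttstt + \<xi>\<^sub>1 * f Wsttss"
| "left_t f Wsstts = f Wsstt + \<xi>\<^sub>1 * f Wssttss"
| "left_t f Wsttss = f Wtsst - \<xi>\<^sub>2 * f Wsstts - \<xi>\<^sub>2^2 * f Wssttss"
| "left_t f Wssttss = f Wsstts + \<xi>\<^sub>2 * f Wssttss"

lemma UNIV_ix: "UNIV = {W1, Ws, Wt, Wss, Wtt, Wst, Wts, Wstt, Wtts, Wsst, Wtss, Wsstt, Wttss, Wstts,
    Wtsst, Wsstss, Wttstt, Wststst, Wsts, Wstss, Wssts, Wsstts, Wsttss, Wssttss}"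
proof -
  have "i \<in> {W1, Ws, Wt, Wss, Wtt, Wst, Wts, Wstt, Wtts, Wsst, Wtss, Wsstt, Wttss, Wstts,
    Wtsst, Wsstss, Wttstt, Wststst, Wsts, Wstss, Wssts, Wsstts, Wsttss, Wssttss}" for i
    by (cases i) simp_all
  then show ?thesis by blast
qed

instance basis_ix :: finite
  by standard (simp add: UNIV_ix)

lemma sum_ix: "(\<Sum>i\<in>UNIV. g i) =
     g W1 + g Ws + g Wt + g Wss + g Wtt + g Wst + g Wts + g Wstt + g Wtts + g Wsst +
     g Wtss + g Wsstt + g Wttss + g Wstts + g Wtsst + g Wsstss + g Wttstt + g Wststst +
     g Wsts + g Wstss + g Wssts + g Wsstts + g Wsttss + g Wssttss"
  for g :: "basis_ix \<Rightarrow> 'a::comm_monoid_add"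
  unfolding UNIV_ix by (simp add: add.assoc)

lemma all_ix: "(\<forall>i. P i) \<longleftrightarrow> P W1 \<and> P Ws \<and> P Wt \<and> P Wss \<and> P Wtt \<and> P Wst \<and> P Wts \<and> P Wstt \<and> P Wtts \<and>
     P Wsst \<and> P Wtss \<and> P Wsstt \<and> P Wttss \<and> P Wstts \<and> P Wtsst \<and> P Wsstss \<and> P Wttstt \<and> P Wststst \<and>
     P Wsts \<and> P Wstss \<and> P Wssts \<and> P Wsstts \<and> P Wsttss \<and> P Wssttss"
proof -
  have "(\<forall>i. P i) \<longleftrightarrow> (\<forall>i\<in>UNIV. P i)" by simp
  then show ?thesis unfolding UNIV_ix by simp
qed

lemma B_sts_eq: "B_sts = range word_of"
  unfolding B_sts_def UNIV_ix by simp

lemma inj_word_of: "inj word_of"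
proof (rule injI)
  show "i = j" if "word_of i = word_of j" for i j
    using that by (cases i; cases j) simp_all
qed

section \<open>Relations between the multiplication matrices\<close>

fun left :: "gen \<Rightarrow> (basis_ix \<Rightarrow> R) \<Rightarrow> basis_ix \<Rightarrow> R" where
  "left S = left_s"
| "left T = left_t"

text \<open>Precomposition with \<open>rev_ix\<close> gives the coordinates of the reversed element.
  That this conjugate of \<open>left\<close> computes right multiplication is shown in
  \<open>comb_gen\<close>.\<close>

definition right :: "gen \<Rightarrow> (basis_ix \<Rightarrow> R) \<Rightarrow> basis_ix \<Rightarrow> R" where
  "right x f = left x (f \<circ> rev_ix) \<circ> rev_ix"

lemma left_add: "left x (\<lambda>i. f i + g i) j = left x f j + left x g j"
  by (cases x; cases j) (simp_all add: algebra_simps)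

lemma left_scale: "left x (\<lambda>i. c * f i) j = c * left x f j"
  by (cases x; cases j) (simp_all add: algebra_simps)

lemma left_braid: "left S (left T (left S f)) = left T (left S (left T f))"
proof
  fix i
  show "left S (left T (left S f)) i = left T (left S (left T f)) i"
    by (cases i) (simp_all add: algebra_simps power2_eq_square)
qed

lemma left_cubic:
  "left x (left x (left x f)) i = f i + \<xi>\<^sub>1 * left x f i + \<xi>\<^sub>2 * left x (left x f) i"
  by (cases x; cases i) (simp_all add: algebra_simps power2_eq_square)

text \<open>An entrywise check, which takes the place of a proof that reversal descends to an
  anti-automorphism of the quotient.\<close>

lemma right_left: "right y (left x f) = left x (right y f)"
proof
  fix i
  show "right y (left x f) i = left x (right y f) i"
    by (cases x; cases y; cases i) (simp_all add: right_def algebra_simps power2_eq_square)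
qed

lemma left_zero: "left x (\<lambda>i. 0) = (\<lambda>i. 0)"
  using left_scale [of x 0] by auto

section \<open>Action of the free algebra and its descent to the Hecke algebra\<close>

definition left_word :: "gen list \<Rightarrow> (basis_ix \<Rightarrow> R) \<Rightarrow> basis_ix \<Rightarrow> R" where
  "left_word w = foldr left w"

lemma left_word_simps [simp]:
  "left_word [] = id" "left_word (x # w) = left x \<circ> left_word w"
  by (simp_all add: left_word_def)

lemma left_word_append: "left_word (u @ v) = left_word u \<circ> left_word v"
  by (induction u) auto

lemma left_word_add: "left_word w (\<lambda>i. f i + g i) = (\<lambda>i. left_word w f i + left_word w g i)"
  by (induction w) (auto simp: left_add)

lemma left_word_scale: "left_word w (\<lambda>i. c * f i) = (\<lambda>i. c * left_word w f i)"
  by (induction w) (auto simp: left_scale)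

lemma left_word_zero: "left_word w (\<lambda>i. 0) = (\<lambda>i. 0)"
  by (induction w) (simp_all add: left_zero)

primrec letters :: "word \<Rightarrow> gen list" where
  "letters (Word w) = w"

lemma letters_simps [simp]: "letters 0 = []" "letters (u + v) = letters u @ letters v"
  by (simp add: zero_word_def) (cases u; cases v; simp)

definition free_act :: "free_alg \<Rightarrow> (basis_ix \<Rightarrow> R) \<Rightarrow> basis_ix \<Rightarrow> R" where
  "free_act a f i =
     (\<Sum>k\<in>Poly_Mapping.keys a. Poly_Mapping.lookup a k * left_word (letters k) f i)"

text \<open>Coefficients vanish off the support; enlarging the index set lets two sums be added over
  a common one.\<close>

lemma free_act_superset:
  assumes "finite A" "Poly_Mapping.keys a \<subseteq> A"
  shows "free_act a f i = (\<Sum>k\<in>A. Poly_Mapping.lookup a k * left_word (letters k) f i)"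
  unfolding free_act_def using assms by (intro sum.mono_neutral_left) (auto simp: in_keys_iff)

lemma free_act_0 [simp]: "free_act 0 f = (\<lambda>i. 0)"
  by (simp add: free_act_def fun_eq_iff)

lemma free_act_single [simp]:
  "free_act (Poly_Mapping.single k c) f = (\<lambda>i. c * left_word (letters k) f i)"
  by (simp add: free_act_def fun_eq_iff)

lemma free_act_add: "free_act (a + b) f = (\<lambda>i. free_act a f i + free_act b f i)"
proof
  fix i
  let ?A = "Poly_Mapping.keys a \<union> Poly_Mapping.keys b"
  have "finite ?A" by simp
  moreover have "Poly_Mapping.keys (a + b) \<subseteq> ?A" by (rule Poly_Mapping.keys_add)
  ultimately show "free_act (a + b) f i = free_act a f i + free_act b f i"
    by (simp add: free_act_superset [of ?A] lookup_add sum.distrib algebra_simps)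
qed

lemma free_act_diff: "free_act (a - b) f = (\<lambda>i. free_act a f i - free_act b f i)"
  using free_act_add [of "a - b" b f] by (simp add: fun_eq_iff)

lemma free_act_vec_scale: "free_act a (\<lambda>i. c * f i) = (\<lambda>i. c * free_act a f i)"
  by (simp add: free_act_def left_word_scale fun_eq_iff sum_distrib_left algebra_simps)

lemma free_act_mult_single:
  "free_act (Poly_Mapping.single k c * b) f = free_act (Poly_Mapping.single k c) (free_act b f)"
proof (induction b rule: free_alg_induct)
  case zero
  then show ?case by (simp add: left_word_zero)
qed (simp_all add: mult_single left_word_append left_word_scale left_word_add
    distrib_left free_act_add algebra_simps)

lemma free_act_mult: "free_act (a * b) f = free_act a (free_act b f)"
  by (induction a rule: free_alg_induct)
    (simp_all add: free_act_mult_single distrib_right free_act_add)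

lemma free_act_1 [simp]: "free_act 1 f = f"
  using free_act_single [of 0 1 f] by simp

lemma free_act_fgen [simp]: "free_act (fgen x) = left x"
  by (simp add: fgen_def fun_eq_iff)

lemma free_act_fconst [simp]: "free_act (fconst c) f = (\<lambda>i. c * f i)"
  by (simp add: fconst_def fun_eq_iff)

text \<open>The generators of the ideal act as zero by \<open>left_braid\<close> and
  \<open>left_cubic\<close>. The vector stays arbitrary because in \<open>a * c\<close> the factor
  \<open>a\<close> acts on the image under \<open>c\<close>.\<close>

lemma free_act_ideal: "a \<in> hecke_ideal \<Longrightarrow> free_act a f = (\<lambda>i. 0)"
proof (induction arbitrary: f rule: hecke_ideal.induct)
  case (lmult a c)
  \<comment> \<open>Scaling by 0 shows that \<open>c\<close> maps the zero vector to itself.\<close>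
  then show ?case using free_act_vec_scale [of c 0] by (simp add: free_act_mult)
qed (simp_all add: free_act_mult free_act_diff free_act_add left_braid left_cubic
    power2_eq_square power3_eq_cube algebra_simps del: left.simps)

lift_definition hecke_act :: "hecke \<Rightarrow> (basis_ix \<Rightarrow> R) \<Rightarrow> basis_ix \<Rightarrow> R" is free_act
proof (intro ext)
  show "free_act a f i = free_act b f i" if "hecke_eq a b" for a b f i
    using free_act_ideal [of "a - b" f] that by (simp add: hecke_eq_def free_act_diff fun_eq_iff)
qed

lemma hecke_act_simps:
  "hecke_act 0 f = (\<lambda>i. 0)" "hecke_act 1 f = f"
  "hecke_act (g + h) f = (\<lambda>i. hecke_act g f i + hecke_act h f i)"
  "hecke_act (g * h) f = hecke_act g (hecke_act h f)"
  "hecke_act (c \<cdot>\<^sub>R h) f = (\<lambda>i. c * hecke_act h f i)"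
  "hecke_act (hecke_gen x) f = left x f"
  by (transfer; simp add: free_act_add free_act_mult)+

lemma hecke_act_Tw: "hecke_act (Tw w) f = left_word w f"
  by (induction w) (simp_all add: Tw_def hecke_act_simps)

lemma hecke_act_sum: "hecke_act (\<Sum>i\<in>A. h i) f j = (\<Sum>i\<in>A. hecke_act (h i) f j)"
  by (induction A rule: infinite_finite_induct) (simp_all add: hecke_act_simps)

lemma hecke_induct [case_names gen scale one add mult]:
  assumes "\<And>x. P (hecke_gen x)" "\<And>c h. P h \<Longrightarrow> P (c \<cdot>\<^sub>R h)" "P 1"
    "\<And>g h. P g \<Longrightarrow> P h \<Longrightarrow> P (g + h)" "\<And>g h. P g \<Longrightarrow> P h \<Longrightarrow> P (g * h)"
  shows "P h"
proof -
  have fw: "P (abs_hecke (Poly_Mapping.single (Word w) 1))" for w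
  proof (induction w)
    case Nil
    then show ?case using assms(3) by (simp add: one_hecke_def flip: zero_word_def)
  next
    case (Cons x w)
    have "Poly_Mapping.single (Word (x # w)) 1 = fgen x * Poly_Mapping.single (Word w) 1"
      by (simp add: fgen_def mult_single)
    then show ?case
      using assms(5) [OF assms(1) Cons] by (simp add: hecke_gen.abs_eq times_hecke.abs_eq)
  qed
  have "P (abs_hecke a)" for a
  proof (induction a rule: free_alg_induct)
    case zero
    \<comment> \<open>Zero is obtained as the scalar 0 times 1.\<close>
    show ?case using assms(2) [OF assms(3), of 0] by (simp add: zero_hecke_def)
  next
    case (single w c)
    have "Poly_Mapping.single w c = fconst c * Poly_Mapping.single w 1"
      by (simp add: fconst_def mult_single)
    then show ?case
      using assms(2) [OF fw, of c "letters w"]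
      by (cases w) (simp add: hecke_scale.abs_eq)
  next
    case (add f g)
    then show ?case using assms(4) [OF add] by (simp add: plus_hecke.abs_eq)
  qed
  from this [of "rep_hecke h"] show ?thesis by (simp add: Quotient_abs_rep [OF Quotient_hecke])
qed

section \<open>Coordinates: the words span and are independent\<close>

definition unit_vec :: "basis_ix \<Rightarrow> basis_ix \<Rightarrow> R" where
  "unit_vec i j = (if j = i then 1 else 0)"

definition comb :: "(basis_ix \<Rightarrow> R) \<Rightarrow> hecke" where
  "comb f = (\<Sum>i\<in>UNIV. f i \<cdot>\<^sub>R Tw (word_of i))"

lemma hecke_comb_eq: "hecke_comb r = comb (r \<circ> word_of)"
  by (simp add: hecke_comb_def comb_def B_sts_eq sum.reindex [OF inj_word_of])

lemma comb_add: "comb (\<lambda>i. f i + g i) = comb f + comb g"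
  by (simp add: comb_def hecke.scale_left_distrib sum.distrib)

lemma comb_scale: "comb (\<lambda>i. c * f i) = c \<cdot>\<^sub>R comb f"
  by (simp add: comb_def hecke.scale_sum_right)

lemma comb_unit_vec: "comb (unit_vec i) = Tw (word_of i)"
proof -
  have "comb (unit_vec i) = (\<Sum>j\<in>UNIV. if j = i then Tw (word_of i) else 0)"
    unfolding comb_def by (rule sum.cong) (auto simp: unit_vec_def)
  then show ?thesis by simp
qed

lemma vec_induct [case_names zero unit add scale]:
  fixes f :: "basis_ix \<Rightarrow> R"
  assumes "P (\<lambda>_. 0)" "\<And>i. P (unit_vec i)" "\<And>f g. P f \<Longrightarrow> P g \<Longrightarrow> P (\<lambda>i. f i + g i)"
    "\<And>c f. P f \<Longrightarrow> P (\<lambda>i. c * f i)"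
  shows "P f"
proof -
  have "P (\<lambda>j. \<Sum>i\<in>A. f i * unit_vec i j)" for A
    by (induction A rule: infinite_finite_induct) (simp_all add: assms)
  from this [of UNIV] have "P (\<lambda>j. \<Sum>i\<in>UNIV. f i * unit_vec i j)" .
  also have "(\<lambda>j. \<Sum>i\<in>UNIV. f i * unit_vec i j) = f"
    by (simp add: unit_vec_def if_distrib cong: if_cong)
  finally show ?thesis .
qed

text \<open>Here the matrices meet the algebra: rewriting brings each of the 48 products to its
  normal form, whose coefficients are a column of the matrix.\<close>

lemma gen_Tw: "hecke_gen x * Tw (word_of i) = comb (left x (unit_vec i))"
  by (cases x; cases i)
    (simp_all add: comb_def sum_ix unit_vec_def Tw_def gen_simps hecke_scale_simps
      algebra_simps power2_eq_square)

lemma gen_comb: "hecke_gen x * comb f = comb (left x f)"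
proof (induction f rule: vec_induct)
  case zero
  then show ?case by (simp add: comb_def left_zero)
next
  case (unit i)
  then show ?case by (simp add: comb_unit_vec gen_Tw)
next
  case (add f g)
  then show ?case by (simp add: comb_add left_add [abs_def] distrib_left)
next
  case (scale c f)
  then show ?case by (simp add: comb_scale left_scale [abs_def] hecke_scale_mult_right)
qed

lemma mult_comb: "h * comb f = comb (hecke_act h f)"
  by (induction h arbitrary: f rule: hecke_induct)
    (simp_all add: gen_comb hecke_act_simps comb_add comb_scale hecke_scale_mult_left
      distrib_right mult.assoc)

definition coord :: "hecke \<Rightarrow> basis_ix \<Rightarrow> R" where
  "coord h = hecke_act h (unit_vec W1)"

text \<open>Since \<open>h = h * 1\<close>, acting on the vector of 1 gives coordinates of
  \<open>h\<close>; hence the words span.\<close>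

lemma comb_coord: "comb (coord h) = h"
  using mult_comb [of h "unit_vec W1"] by (simp add: coord_def comb_unit_vec Tw_def)

lemma left_word_unit_vec: "left_word (word_of i) (unit_vec W1) = unit_vec i"
proof
  fix j
  show "left_word (word_of i) (unit_vec W1) j = unit_vec i j"
    by (cases i; cases j) (simp_all add: unit_vec_def)
qed

text \<open>Each basis word carries the vector of 1 to its own unit vector, so the action recovers
  the coefficients; hence the words are independent.\<close>

lemma coord_comb: "coord (comb f) = f"
  by (simp add: coord_def comb_def fun_eq_iff hecke_act_sum hecke_act_simps hecke_act_Tw
      left_word_unit_vec unit_vec_def if_distrib cong: if_cong)

lemma comb_eq_iff: "comb f = comb g \<longleftrightarrow> f = g"
  by (metis coord_comb)

section \<open>Right multiplication and a criterion for centrality\<close>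

lemma hecke_act_right: "hecke_act h (right x f) = right x (hecke_act h f)"
proof (induction h arbitrary: f rule: hecke_induct)
  case (scale c h)
  then show ?case by (simp add: hecke_act_simps right_def left_scale [abs_def] comp_def fun_eq_iff)
next
  case (add g h)
  then show ?case by (simp add: hecke_act_simps right_def left_add [abs_def] comp_def fun_eq_iff)
qed (simp_all add: hecke_act_simps right_left)

lemma right_unit_vec: "right x (unit_vec W1) = left x (unit_vec W1)"
proof
  fix j
  show "right x (unit_vec W1) j = left x (unit_vec W1) j"
    by (cases x; cases j) (simp_all add: right_def unit_vec_def)
qed

text \<open>Left and right matrices of a generator agree on the vector of 1, and the right one
  commutes with the whole left action, so it can be pulled out in front.\<close>

lemma comb_gen: "comb f * hecke_gen x = comb (right x f)"
proof -
  have "coord (comb f * hecke_gen x) = right x (coord (comb f))"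
    by (simp add: coord_def hecke_act_simps right_unit_vec [symmetric] hecke_act_right)
  then show ?thesis by (metis comb_coord coord_comb)
qed

text \<open>Commuting with the two generators suffices, since the elements commuting with
  \<open>comb f\<close> form a subalgebra.\<close>

lemma comb_centre_iff: "comb f \<in> hecke_centre \<longleftrightarrow> (\<forall>x. right x f = left x f)"
proof
  assume "comb f \<in> hecke_centre"
  then show "\<forall>x. right x f = left x f"
    unfolding hecke_centre_def by (metis (mono_tags, lifting) comb_eq_iff comb_gen gen_comb mem_Collect_eq)
next
  assume *: "\<forall>x. right x f = left x f"
  have "comb f * h = h * comb f" for h
  proof (induction h rule: hecke_induct)
    case (mult g h)
    then show ?case by (metis mult.assoc)
  qed (simp_all add: comb_gen gen_comb * hecke_scale_mult_left hecke_scale_mult_right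
      distrib_left distrib_right)
  then show "comb f \<in> hecke_centre" by (simp add: hecke_centre_def)
qed


section \<open>The centre\<close>

text \<open>The right sides of the relations of the theorem as one linear map: it keeps the seven
  coordinates at the representatives and recomputes all others from them.\<close>

primrec class_extend :: "(basis_ix \<Rightarrow> R) \<Rightarrow> basis_ix \<Rightarrow> R" where
  "class_extend f W1 = f W1"
| "class_extend f Ws = f Ws"
| "class_extend f Wt = f Ws + \<xi>\<^sub>1 * f Wtts + \<xi>\<^sub>1 * \<xi>\<^sub>2 * f Wttss"
| "class_extend f Wss = f Wss"
| "class_extend f Wtt = f Wss"
| "class_extend f Wst = f Wts"
| "class_extend f Wts = f Wts"
| "class_extend f Wstt = f Wtts"
| "class_extend f Wtts = f Wtts"
| "class_extend f Wsst = (1 + \<xi>\<^sub>1 * \<xi>\<^sub>2) * f Wtts + \<xi>\<^sub>1 * f Wss + \<xi>\<^sub>1 * (\<xi>\<^sub>1 + \<xi>\<^sub>2^2) * f Wttss"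
| "class_extend f Wtss = (1 + \<xi>\<^sub>1 * \<xi>\<^sub>2) * f Wtts + \<xi>\<^sub>1 * f Wss + \<xi>\<^sub>1 * (\<xi>\<^sub>1 + \<xi>\<^sub>2^2) * f Wttss"
| "class_extend f Wsstt = f Wttss"
| "class_extend f Wttss = f Wttss"
| "class_extend f Wstts = f Wttss + \<xi>\<^sub>1 * f Wtts - \<xi>\<^sub>2 * f Wss"
| "class_extend f Wtsst = (1 + 2 * \<xi>\<^sub>1 * \<xi>\<^sub>2 + \<xi>\<^sub>2^3) * f Wttss + \<xi>\<^sub>2 * f Wss + (\<xi>\<^sub>1 + \<xi>\<^sub>2^2) * f Wtts"
| "class_extend f Wsstss = f Wts + \<xi>\<^sub>2 * (1 + \<xi>\<^sub>1 * \<xi>\<^sub>2) * f Wtts + \<xi>\<^sub>1 * \<xi>\<^sub>2 * f Wss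
                        + \<xi>\<^sub>1 * \<xi>\<^sub>2 * (\<xi>\<^sub>1 + \<xi>\<^sub>2^2) * f Wttss"
| "class_extend f Wttstt = f Wts + \<xi>\<^sub>2 * (2 + \<xi>\<^sub>1 * \<xi>\<^sub>2) * f Wtts + \<xi>\<^sub>1 * \<xi>\<^sub>2 * f Wss
                        + \<xi>\<^sub>2 * (\<xi>\<^sub>2 + \<xi>\<^sub>1 * \<xi>\<^sub>2^2 + \<xi>\<^sub>1^2) * f Wttss"
| "class_extend f Wststst = f Wststst"
| "class_extend f Wsts = f Wtts + \<xi>\<^sub>1 * f Wts + \<xi>\<^sub>1^2 * f Wttss + \<xi>\<^sub>1 * f Wss - \<xi>\<^sub>2 * f Ws"
| "class_extend f Wstss = f Ws + \<xi>\<^sub>1 * (2 + \<xi>\<^sub>1 * \<xi>\<^sub>2) * f Wtts + \<xi>\<^sub>1^2 * f Wss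
                      + \<xi>\<^sub>1 * (\<xi>\<^sub>2 + \<xi>\<^sub>1 * \<xi>\<^sub>2^2 + \<xi>\<^sub>1^2) * f Wttss"
| "class_extend f Wssts = f Ws + \<xi>\<^sub>1 * (2 + \<xi>\<^sub>1 * \<xi>\<^sub>2) * f Wtts + \<xi>\<^sub>1^2 * f Wss
                      + \<xi>\<^sub>1 * (\<xi>\<^sub>2 + \<xi>\<^sub>1 * \<xi>\<^sub>2^2 + \<xi>\<^sub>1^2) * f Wttss"
| "class_extend f Wsstts = f Wss + \<xi>\<^sub>1 * f Wttss"
| "class_extend f Wsttss = f Wss + \<xi>\<^sub>1 * f Wttss"
| "class_extend f Wssttss = f Wtts + \<xi>\<^sub>2 * f Wttss"

lemma class_extend_commutes: "right x (class_extend f) = left x (class_extend f)"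
proof
  fix i
  show "right x (class_extend f) i = left x (class_extend f) i"
    by (cases x; cases i)
      (simp_all add: right_def algebra_simps power2_eq_square power3_eq_cube)
qed

lemma commutes_class_extend:
  assumes "\<And>x. right x f = left x f"
  shows "f = class_extend f"
proof -
  have e: "right x f i = left x f i" for x i
    using assms by simp
  \<comment> \<open>In these five rows all terms cancel except a coordinate and that of the reversed
    word.\<close>
  have sst: "f Wsst = f Wtss" and stt: "f Wstt = f Wtts" and sstt: "f Wsstt = f Wttss"
    and sstts: "f Wsstts = f Wsttss" and ssts: "f Wssts = f Wstss"
    using e [of S Wt] e [of T Ws] e [of T Wss] e [of T Wssttss] e [of S Wsstss]
    by (simp_all add: right_def)
  note eqs = sst stt sstt sstts ssts
  have ssttss: "f Wssttss = f Wtts + \<xi>\<^sub>2 * f Wttss"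
    using e [of S Wttss] by (simp add: right_def)
  have tsst: "f Wtsst = f Wttss + \<xi>\<^sub>2 * f Wsttss + (\<xi>\<^sub>2 * \<xi>\<^sub>2 + \<xi>\<^sub>1) * f Wssttss"
    using e [of T Wsstts] unfolding right_def comp_def rev_ix.simps left.simps left_t.simps eqs
    by algebra
  \<comment> \<open>Substituting \<open>tsst\<close> for \<open>f Wtsst\<close> cancels
    \<open>f Wssttss\<close> as well as the multiples of \<open>f Wsttss\<close> other than the
    coordinate itself.\<close>
  have sttss: "f Wsttss = f Wss + \<xi>\<^sub>1 * f Wttss"
    using e [of T Wsst] tsst unfolding right_def comp_def rev_ix.simps left.simps left_t.simps eqs
    by algebra
  have tt: "f Wtt = f Wss"
    using e [of S Wtts] by (simp add: right_def eqs sttss)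
  have tss: "f Wtss = (1 + \<xi>\<^sub>1 * \<xi>\<^sub>2) * f Wtts + \<xi>\<^sub>1 * f Wss + \<xi>\<^sub>1 * (\<xi>\<^sub>1 + \<xi>\<^sub>2^2) * f Wttss"
    using e [of T Wttss] ssttss sttss
    unfolding right_def comp_def rev_ix.simps left.simps left_t.simps eqs by algebra
  have st: "f Wst = f Wts"
    using e [of S Wsts] by (simp add: right_def eqs)
  have stss: "f Wstss = f Ws + \<xi>\<^sub>1 * (2 + \<xi>\<^sub>1 * \<xi>\<^sub>2) * f Wtts + \<xi>\<^sub>1^2 * f Wss
                      + \<xi>\<^sub>1 * (\<xi>\<^sub>2 + \<xi>\<^sub>1 * \<xi>\<^sub>2^2 + \<xi>\<^sub>1^2) * f Wttss"
    using e [of T Wts] ssttss sttss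
    unfolding right_def comp_def rev_ix.simps left.simps left_t.simps eqs by algebra
  have t: "f Wt = f Ws + \<xi>\<^sub>1 * f Wtts + \<xi>\<^sub>1 * \<xi>\<^sub>2 * f Wttss"
  proof -
    \<comment> \<open>Both coordinates on the right are already solved for; in their difference the
      multiples of \<open>f Wss\<close> cancel.\<close>
    have "f Wt = f Wstss - \<xi>\<^sub>1 * f Wtss"
      using e [of S Wts] unfolding right_def comp_def rev_ix.simps left.simps left_s.simps eqs
      by (simp add: eq_diff_eq)
    then show ?thesis by (simp add: stss tss algebra_simps power2_eq_square)
  qed
  have sstss: "f Wsstss = f Wts + \<xi>\<^sub>2 * f Wtss"
    using e [of S Wtss] by (simp add: right_def eqs)
  have sts: "f Wsts = \<xi>\<^sub>1 * f Wsstss - \<xi>\<^sub>2 * f Wstss + f Wtss"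
    using e [of S Wssts] unfolding right_def comp_def rev_ix.simps left.simps left_s.simps eqs
    by algebra
  have ttstt: "f Wttstt = (\<xi>\<^sub>2 - \<xi>\<^sub>1 * \<xi>\<^sub>1) * f Wssttss + \<xi>\<^sub>1 * f Wtsst - \<xi>\<^sub>1 * f Wttss + \<xi>\<^sub>2 * f Wtts + f Wts"
    using e [of T Wtts] st unfolding right_def comp_def rev_ix.simps left.simps left_t.simps eqs
    by algebra
  have stts: "f Wstts = \<xi>\<^sub>1 * f Wssttss - \<xi>\<^sub>2 * f Wsttss + f Wttss"
    using e [of S Wsstts] unfolding right_def comp_def rev_ix.simps left.simps left_s.simps eqs
    by algebra
  show ?thesis
  proof
    fix i
    show "f i = class_extend f i"
      by (cases i)
        (simp_all add: eqs t tt st stts sts ttstt sstss stss tss tsst ssttss sttss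
          algebra_simps power2_eq_square power3_eq_cube)
  qed
qed

lemma comb_centre_iff_class_extend: "comb f \<in> hecke_centre \<longleftrightarrow> f = class_extend f"
  unfolding comb_centre_iff by (metis class_extend_commutes commutes_class_extend)

section \<open>A basis of the centre\<close>

definition class_reps :: "basis_ix set" where
  "class_reps = {W1, Ws, Wss, Wts, Wtts, Wttss, Wststst}"

text \<open>By linearity the values on unit vectors are the matrix entries. They later serve as the
  coefficients of the distinguished set.\<close>

lemma class_extend_expand: "class_extend f j = (\<Sum>i\<in>class_reps. class_extend (unit_vec i) j * f i)"
  by (cases j) (simp_all add: class_reps_def unit_vec_def algebra_simps)

lemma class_extend_rep: "i \<in> class_reps \<Longrightarrow> class_extend f i = f i"
  by (auto simp: class_reps_def)

text \<open>The map reads only the representatives and fixes their coordinates, so it is a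
  projection.\<close>

lemma class_extend_idem: "class_extend (class_extend f) = class_extend f"
proof
  show "class_extend (class_extend f) i = class_extend f i" for i
    by (cases i) simp_all
qed

lemma comb_sum: "comb (\<lambda>i. \<Sum>k\<in>A. c k * g k i) = (\<Sum>k\<in>A. c k \<cdot>\<^sub>R comb (g k))"
proof (induction A rule: infinite_finite_induct)
  case (insert k A)
  then show ?case by (simp add: comb_add comb_scale)
qed (simp_all add: comb_def)

text \<open>The basis dual to the coordinates at the representatives: each member has coordinate 1
  at one of them and 0 at the other six.\<close>

definition class_basis :: "hecke set" where
  "class_basis = (\<lambda>i. comb (class_extend (unit_vec i))) ` class_reps"

lemma comb_class_extend:
  "comb (class_extend f) = (\<Sum>i\<in>class_reps. f i \<cdot>\<^sub>R comb (class_extend (unit_vec i)))"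
  by (subst comb_sum [symmetric]) (simp add: class_extend_expand [of f, abs_def] mult.commute)

lemma inj_class_basis: "inj_on (\<lambda>i. comb (class_extend (unit_vec i))) class_reps"
proof (rule inj_onI)
  fix i j
  assume i: "i \<in> class_reps" and j: "j \<in> class_reps"
    and "comb (class_extend (unit_vec i)) = comb (class_extend (unit_vec j))"
  then have "class_extend (unit_vec i) j = class_extend (unit_vec j) j"
    by (simp add: comb_eq_iff)
  then show "i = j"
    using i j by (simp add: class_extend_rep unit_vec_def split: if_splits)
qed

lemma finite_class_reps: "finite class_reps"
  by (simp add: class_reps_def)

lemma is_R_basis_class_basis: "is_R_basis class_basis hecke_centre"
proof -
  have fin: "finite class_basis"
    unfolding class_basis_def by (rule finite_imageI [OF finite_class_reps])
  have "hecke.independent class_basis"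
  proof
    assume "hecke.dependent class_basis"
    then obtain u z where *: "(\<Sum>x\<in>class_basis. u x \<cdot>\<^sub>R x) = 0"
      and z: "z \<in> class_basis" "u z \<noteq> 0"
      using hecke.dependent_finite [OF fin] by blast
    \<comment> \<open>The coefficients of the linear relation, moved to indices; reading the
      vanishing combination at a representative returns the coefficient there.\<close>
    define v where "v i = u (comb (class_extend (unit_vec i)))" for i
    have "comb (class_extend v) = 0"
      using * unfolding comb_class_extend [of v] class_basis_def sum.reindex [OF inj_class_basis]
      by (simp add: v_def)
    then have "comb (class_extend v) = comb (\<lambda>_. 0)"
      by (simp add: comb_def)
    then have "class_extend v = (\<lambda>_. 0)"
      by (simp add: comb_eq_iff)
    moreover obtain i where "i \<in> class_reps" "z = comb (class_extend (unit_vec i))"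
      using z by (auto simp: class_basis_def)
    ultimately show False
      using class_extend_rep [of i v] z by (simp add: v_def)
  qed
  moreover have "hecke.span class_basis = hecke_centre"
  proof
    show "hecke_centre \<subseteq> hecke.span class_basis"
    proof
      fix z assume "z \<in> hecke_centre"
      then have "coord z = class_extend (coord z)"
        using comb_centre_iff_class_extend [of "coord z"] by (simp add: comb_coord)
      then have "z = (\<Sum>i\<in>class_reps. coord z i \<cdot>\<^sub>R comb (class_extend (unit_vec i)))"
        using comb_class_extend [of "coord z"] by (simp add: comb_coord)
      also have "\<dots> \<in> hecke.span class_basis"
        by (intro hecke.span_sum hecke.span_scale hecke.span_base) (simp add: class_basis_def)
      finally show "z \<in> hecke.span class_basis" .
    qed
    have sub: "hecke.subspace hecke_centre"
      by (rule hecke.subspaceI)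
        (simp_all add: hecke_centre_def distrib_left distrib_right hecke_scale_mult_left hecke_scale_mult_right)
    show "hecke.span class_basis \<subseteq> hecke_centre"
    proof (rule hecke.span_minimal [OF _ sub])
      show "class_basis \<subseteq> hecke_centre"
        by (auto simp: class_basis_def comb_centre_iff_class_extend class_extend_idem)
    qed
  qed
  ultimately show ?thesis by (simp add: is_R_basis_def)
qed


section \<open>Conjugacy classes and reduced words of \<open>G\<^sub>4\<close>\<close>

lemma g4_eq_equivp: "equivp g4_eq"
  by (rule equivpI) (auto simp: reflp_def symp_def transp_def intro: g4_eq.intros)

\<comment> \<open>A type copy of the group, so that the simplifier can rewrite products in the class
  \<open>monoid_mult\<close>.\<close>
quotient_type g4 = gword / g4_eq
  by (rule g4_eq_equivp)

instantiation g4 :: monoid_mult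
begin
lift_definition one_g4 :: g4 is "[]" .
lift_definition times_g4 :: "g4 \<Rightarrow> g4 \<Rightarrow> g4" is "(@)"
  by (rule g4_eq.append)
instance by standard (transfer; simp add: g4_eq.refl)+
end

abbreviation g4_letter :: "gen \<Rightarrow> g4" where
  "g4_letter x \<equiv> abs_g4 [(x, True)]"

abbreviation Gs :: g4 where "Gs \<equiv> g4_letter S"
abbreviation Gt :: g4 where "Gt \<equiv> g4_letter T"

lemma abs_g4_Cons: "abs_g4 (a # u) = abs_g4 [a] * abs_g4 u"
  by (simp add: times_g4.abs_eq)

lemma abs_g4_append: "abs_g4 (u @ v) = abs_g4 u * abs_g4 v"
  by (simp add: times_g4.abs_eq)

lemma abs_g4_Nil: "abs_g4 [] = 1"
  by (simp add: one_g4_def)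

lemma g4_order3: "g4_letter x * (g4_letter x * g4_letter x) = 1"
  using g4_eq.order3 [of x] by (simp add: gword_of_def times_g4.abs_eq one_g4_def g4.abs_eq_iff)

lemma g4_braid: "Gt * (Gs * Gt) = Gs * (Gt * Gs)"
  using g4_eq.sym [OF g4_eq.braid] by (simp add: gword_of_def times_g4.abs_eq g4.abs_eq_iff)

lemma g4_order3_tail: "g4_letter x * (g4_letter x * (g4_letter x * z)) = z"
  using mult_left_tail(2) [OF g4_order3] by simp

text \<open>As generators have order 3, inverses are squares and positive words represent every
  element.\<close>

lemma g4_inverse_letter: "abs_g4 [(x, False)] = g4_letter x * g4_letter x"
proof -
  have "abs_g4 [(x, False)] * g4_letter x = 1"
    using g4_eq.cancel [of x False] by (simp add: times_g4.abs_eq one_g4_def g4.abs_eq_iff)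
  then have "abs_g4 [(x, False)] * (g4_letter x * (g4_letter x * g4_letter x)) = g4_letter x * g4_letter x"
    by (metis mult.assoc mult_1)
  then show ?thesis by (simp add: g4_order3)
qed

lemma g4_tssts: "Gt * (Gs * (Gs * (Gt * Gs))) = Gs * (Gt * (Gs * (Gs * Gt)))"
  by (rule braid_tssts [OF g4_braid])

lemma g4_stsstt: "Gs * (Gt * (Gs * (Gs * (Gt * Gt)))) = Gt * (Gt * Gs)"
  by (simp only: braid_stsstt [OF g4_braid] g4_order3_tail)

lemma g4_tsstt: "Gt * (Gs * (Gs * (Gt * Gt))) = Gs * (Gs * (Gt * (Gt * Gs)))"
  by (simp only: g4_stsstt [symmetric] g4_order3_tail)

text \<open>As in the Hecke algebra, two reductions of \<open>tssttst\<close> give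
  \<open>ssttsst = ttss\<close>; a factor \<open>s\<close> in front then cancels
  \<open>sss\<close>.\<close>

lemma g4_ttsst: "Gt * (Gt * (Gs * (Gs * Gt))) = Gs * (Gt * (Gt * (Gs * Gs)))"
proof -
  have "Gs * (Gs * (Gt * (Gt * (Gs * (Gs * Gt))))) = Gs * (Gs * (Gt * (Gt * Gs))) * (Gs * Gt)"
    by (simp only: mult.assoc)
  also have "\<dots> = Gt * (Gs * (Gs * (Gt * (Gt * (Gs * Gt)))))"
    by (simp only: g4_tsstt [symmetric] mult.assoc)
  also have "\<dots> = Gt * (Gt * (Gs * Gs))"
    by (simp only: g4_braid mult_left_tail(2) [OF g4_braid] g4_order3_tail mult.assoc)
  finally have "Gs * (Gs * (Gs * (Gt * (Gt * (Gs * (Gs * Gt)))))) = Gs * (Gt * (Gt * (Gs * Gs)))"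
    by simp
  then show ?thesis by (simp only: g4_order3_tail)
qed

lemmas g4_simps = g4_order3 g4_order3_tail g4_braid mult_left_tail(2) [OF g4_braid]
  g4_tssts mult_left_tail(3) [OF g4_tssts] g4_stsstt mult_left_tail(4) [OF g4_stsstt]
  g4_tsstt mult_left_tail(3) [OF g4_tsstt] g4_ttsst mult_left_tail(3) [OF g4_ttsst] mult.assoc

definition g4_word :: "gen list \<Rightarrow> g4" where
  "g4_word w = abs_g4 (gword_of w)"

lemma g4_word_simps: "g4_word [] = 1" "g4_word (x # w) = g4_letter x * g4_word w"
  by (simp_all add: g4_word_def gword_of_def abs_g4_Nil times_g4.abs_eq)

text \<open>The 24 normal words are closed under left multiplication by letters, so the group has at
  most 24 elements.\<close>

lemma g4_letter_mult_normal: "g4_letter x * g4_word (word_of i) \<in> range (g4_word \<circ> word_of)"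
  unfolding UNIV_ix
  by (cases x; cases i; simp add: g4_word_simps g4_simps)

lemma g4_normal_form: "abs_g4 u \<in> range (g4_word \<circ> word_of)"
proof (induction u)
  case Nil
  have "abs_g4 [] = (g4_word \<circ> word_of) W1" by (simp add: g4_word_simps abs_g4_Nil)
  then show ?case by (rule range_eqI)
next
  case (Cons a u)
  have step: "g4_letter x * g \<in> range (g4_word \<circ> word_of)" if "g \<in> range (g4_word \<circ> word_of)" for x g
    using that g4_letter_mult_normal by auto
  obtain x b where "a = (x, b)" by (cases a)
  then show ?case
    \<comment> \<open>An inverse letter counts as two letters, hence the doubled
      \<open>step\<close>.\<close>
    using step [OF Cons] step [OF step [OF Cons]]
    by (cases b) (simp_all add: abs_g4_Cons [of _ u] g4_inverse_letter mult.assoc)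
qed

text \<open>Conjugacy in the form \<open>h g = m h\<close> avoids inverses, so rewriting to normal
  forms decides it.\<close>

lemma g4_conj_class_rep:
  "\<exists>h. \<exists>m\<in>{[], [S], [S,S], [T,S], [T,T,S], [T,T,S,S], [S,T,S,T,S,T]}.
     g4_word h * g4_word (word_of i) = g4_word m * g4_word h" (is "\<exists>h. ?P h")
proof -
  \<comment> \<open>These eight conjugators suffice for all 24 elements.\<close>
  have "?P [] \<or> ?P [S] \<or> ?P [T] \<or> ?P [S,S] \<or> ?P [T,T] \<or> ?P [S,T] \<or> ?P [T,S] \<or> ?P [S,T,S]"
    by (cases i; simp add: g4_word_simps g4_simps)
  then show ?thesis by blast
qed

section \<open>The Burau representation modulo 13\<close>

type_synonym mat = "int \<times> int \<times> int \<times> int"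

fun mat_mul :: "mat \<Rightarrow> mat \<Rightarrow> mat" where
  "mat_mul (a, b, c, d) (e, f, g, h) =
     ((a * e + b * g) mod 13, (a * f + b * h) mod 13, (c * e + d * g) mod 13, (c * f + d * h) mod 13)"

fun mat_tr :: "mat \<Rightarrow> int" where
  "mat_tr (a, b, c, d) = (a + d) mod 13"

text \<open>
  The reduced Burau representation of the braid group on three strands at a primitive cube root of unity,
  taken to be 3 in the field with 13 elements. Its trace already separates the conjugacy classes.
\<close>

fun mat_letter :: "gen \<times> bool \<Rightarrow> mat" where
  "mat_letter (S, True) = (3, 1, 0, 1)"
| "mat_letter (T, True) = (1, 0, 10, 3)"
| "mat_letter (S, False) = (9, 4, 0, 1)"
| "mat_letter (T, False) = (1, 0, 1, 9)"

fun mat_rep :: "gword \<Rightarrow> mat" where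
  "mat_rep [] = (1, 0, 0, 1)"
| "mat_rep (a # u) = mat_mul (mat_letter a) (mat_rep u)"

lemma mat_mul_assoc: "mat_mul (mat_mul A B) C = mat_mul A (mat_mul B C)"
proof -
  have "(x * (p mod 13) + y * (q mod 13)) mod 13 = (x * p + y * q) mod 13"
    and "((p mod 13) * x + (q mod 13) * y) mod 13 = (p * x + q * y) mod 13" for x y p q :: int
    by (intro mod_add_cong; simp add: mod_simps)+
  then show ?thesis
    by (cases A; cases B; cases C) (simp add: algebra_simps)
qed

lemma mat_tr_commute: "mat_tr (mat_mul A B) = mat_tr (mat_mul B A)"
  by (cases A; cases B) (simp only: mat_mul.simps mat_tr.simps mod_add_eq, simp add: ac_simps)

text \<open>The identity matrix is neutral only on reduced entries, which matrices of the form
  \<open>mat_rep u\<close> have.\<close>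

lemma mat_rep_one: "mat_mul (1, 0, 0, 1) (mat_rep u) = mat_rep u"
proof (cases u)
  case (Cons a v)
  then show ?thesis
    by (cases "mat_letter a"; cases "mat_rep v") (simp add: mod_simps)
qed simp

lemma mat_rep_append: "mat_rep (u @ v) = mat_mul (mat_rep u) (mat_rep v)"
  by (induction u) (simp_all add: mat_rep_one mat_mul_assoc)

lemma mat_rep_eq: "g4_eq u v \<Longrightarrow> mat_rep u = mat_rep v"
proof (induction rule: g4_eq.induct)
  case (cancel x b)
  show ?case by (cases x; cases b) simp_all
next
  case (order3 x)
  show ?case by (cases x) (simp_all add: gword_of_def)
qed (simp_all add: mat_rep_append gword_of_def)

section \<open>Group structure of \<open>G4\<close>\<close>

definition g4_class :: "gword \<Rightarrow> gword set" where
  "g4_class u = g4_rel `` {u}"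

lemma g4_elem_eq: "g4_elem w = g4_class (gword_of w)"
  by (simp add: g4_elem_def g4_class_def)

lemma equiv_g4_rel: "equiv UNIV g4_rel"
  using g4_eq_equivp by (simp add: g4_rel_def equivp_equiv)

text \<open>The bridge from classes as sets, which form the carrier of \<open>G4\<close>, to the
  type \<open>g4\<close>, where rewriting takes place.\<close>

lemma g4_class_eq_iff: "g4_class u = g4_class v \<longleftrightarrow> abs_g4 u = abs_g4 v"
  using eq_equiv_class_iff [OF equiv_g4_rel, of u v] by (simp add: g4_class_def g4_rel_def g4.abs_eq_iff)

definition gword_inv :: "gword \<Rightarrow> gword" where
  "gword_inv u = rev (map (\<lambda>(x, b). (x, \<not> b)) u)"

lemma gword_inv_inv: "gword_inv (gword_inv u) = u"
  by (induction u) (auto simp: gword_inv_def rev_map)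

lemma gword_inv_append: "gword_inv (u @ v) = gword_inv v @ gword_inv u"
  by (simp add: gword_inv_def)

lemma abs_g4_inv_right: "abs_g4 u * abs_g4 (gword_inv u) = 1"
proof (induction u)
  case Nil
  then show ?case by (simp add: gword_inv_def abs_g4_Nil)
next
  case (Cons a u)
  obtain x b where a: "a = (x, b)" by (cases a)
  have cancel: "abs_g4 [(x, b)] * abs_g4 [(x, \<not> b)] = 1"
    using g4_eq.cancel [of x b] by (simp add: times_g4.abs_eq one_g4_def g4.abs_eq_iff)
  have "abs_g4 (a # u) * abs_g4 (gword_inv (a # u)) =
      abs_g4 [a] * (abs_g4 u * abs_g4 (gword_inv u)) * abs_g4 [(x, \<not> b)]"
    by (simp add: a gword_inv_def times_g4.abs_eq)
  also have "\<dots> = 1"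
    by (simp only: Cons a mult_1_right cancel)
  finally show ?case .
qed

lemma abs_g4_inv_left: "abs_g4 (gword_inv u) * abs_g4 u = 1"
  using abs_g4_inv_right [of "gword_inv u"] by (simp add: gword_inv_inv)

lemma carrier_G4: "carrier G4 = range g4_class"
  by (auto simp: G4_def quotient_def g4_class_def)

lemma one_G4: "\<one>\<^bsub>G4\<^esub> = g4_class []"
  by (simp add: G4_def g4_class_def)

lemma mult_G4: "g4_class u \<otimes>\<^bsub>G4\<^esub> g4_class v = g4_class (u @ v)"
proof -
  have "g4_rel `` {u' @ v'} = g4_class (u @ v)" if "g4_eq u u'" "g4_eq v v'" for u' v'
    using that g4_class_eq_iff [of "u' @ v'" "u @ v"]
    by (simp add: g4_class_def abs_g4_append g4.abs_eq_iff [symmetric])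
  then show ?thesis
    by (auto simp: G4_def g4_class_def g4_rel_def intro: g4_eq.refl)
qed

lemma group_G4: "group G4"
proof (rule groupI)
  fix x assume "x \<in> carrier G4"
  then obtain u where "x = g4_class u" by (auto simp: carrier_G4)
  then have "g4_class (gword_inv u) \<otimes>\<^bsub>G4\<^esub> x = \<one>\<^bsub>G4\<^esub>"
    by (simp add: mult_G4 one_G4 g4_class_eq_iff abs_g4_append abs_g4_inv_left abs_g4_Nil)
  then show "\<exists>y\<in>carrier G4. y \<otimes>\<^bsub>G4\<^esub> x = \<one>\<^bsub>G4\<^esub>"
    by (auto simp: carrier_G4)
qed (auto simp: carrier_G4 one_G4 mult_G4)

lemma inv_G4: "inv\<^bsub>G4\<^esub> (g4_class u) = g4_class (gword_inv u)"
proof (rule group.inv_equality [OF group_G4])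
  show "g4_class (gword_inv u) \<otimes>\<^bsub>G4\<^esub> g4_class u = \<one>\<^bsub>G4\<^esub>"
    by (simp add: mult_G4 one_G4 g4_class_eq_iff abs_g4_append abs_g4_inv_left abs_g4_Nil)
qed (auto simp: carrier_G4)

section \<open>Conjugacy classes and their traces\<close>

lemma conj_class_G4: "conj_class G4 (g4_class u) = range (\<lambda>h. g4_class (h @ u @ gword_inv h))"
proof -
  have "conj_class G4 x = (\<lambda>h. h \<otimes>\<^bsub>G4\<^esub> x \<otimes>\<^bsub>G4\<^esub> inv\<^bsub>G4\<^esub> h) ` carrier G4" for x
    by (auto simp: conj_class_def)
  then show ?thesis by (simp add: carrier_G4 image_image mult_G4 inv_G4)
qed

text \<open>Since \<open>u\<close> is \<open>w\<close> conjugated by the inverse of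
  \<open>h\<close>, the conjugator \<open>k\<close> of \<open>u\<close> becomes \<open>k\<close>
  times that inverse for \<open>w\<close>.\<close>

lemma conj_class_subset:
  assumes "abs_g4 h * abs_g4 u = abs_g4 w * abs_g4 h"
  shows "conj_class G4 (g4_class u) \<subseteq> conj_class G4 (g4_class w)"
proof -
  have u: "abs_g4 u = abs_g4 (gword_inv h) * (abs_g4 w * abs_g4 h)"
    by (metis assms abs_g4_inv_left mult.assoc mult_1)
  have "g4_class (k @ u @ gword_inv k) =
      g4_class ((k @ gword_inv h) @ w @ gword_inv (k @ gword_inv h))" for k
    by (simp add: g4_class_eq_iff abs_g4_append gword_inv_append gword_inv_inv u mult.assoc)
  then show ?thesis
    unfolding conj_class_G4 by (intro image_subsetI) (rule range_eqI)
qed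

lemma conj_class_eqI:
  assumes "abs_g4 h * abs_g4 u = abs_g4 w * abs_g4 h"
  shows "conj_class G4 (g4_class u) = conj_class G4 (g4_class w)"
proof
  have "abs_g4 (gword_inv h) * abs_g4 w = abs_g4 u * abs_g4 (gword_inv h)"
    by (metis assms abs_g4_inv_left abs_g4_inv_right mult.assoc mult_1 mult_1_right)
  then show "conj_class G4 (g4_class w) \<subseteq> conj_class G4 (g4_class u)"
    by (rule conj_class_subset)
qed (rule conj_class_subset [OF assms])

text \<open>\<open>u\<close> is a conjugate of \<open>v\<close>, and cyclic invariance of the trace
  brings the conjugator next to its inverse.\<close>

lemma conj_class_eq_imp_tr:
  assumes "conj_class G4 (g4_class u) = conj_class G4 (g4_class v)"
  shows "mat_tr (mat_rep u) = mat_tr (mat_rep v)"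
proof -
  have "g4_class u \<in> conj_class G4 (g4_class u)"
    unfolding conj_class_G4 by (rule range_eqI [of _ _ "[]"]) (simp add: gword_inv_def)
  then obtain h where "g4_class u = g4_class (h @ v @ gword_inv h)"
    unfolding assms unfolding conj_class_G4 by blast
  then have "mat_rep u = mat_rep (h @ v @ gword_inv h)"
    by (simp add: g4_class_eq_iff g4.abs_eq_iff mat_rep_eq)
  also have "mat_tr \<dots> = mat_tr (mat_rep ((v @ gword_inv h) @ h))"
    by (simp only: mat_rep_append mat_tr_commute)
  also have "mat_rep ((v @ gword_inv h) @ h) = mat_rep v"
    by (rule mat_rep_eq) (simp add: g4.abs_eq_iff [symmetric] abs_g4_append mult.assoc abs_g4_inv_left)
  finally show ?thesis .
qed

definition class_words :: "gen list set" where
  "class_words = {[], [S], [S,S], [T,S], [T,T,S], [T,T,S,S], [S,T,S,T,S,T]}"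

lemma bij_betw_conj_classes:
  "bij_betw (\<lambda>w. conj_class G4 (g4_elem w)) class_words (conj_class G4 ` carrier G4)"
  unfolding bij_betw_def
proof
  show "inj_on (\<lambda>w. conj_class G4 (g4_elem w)) class_words"
  proof (rule inj_onI)
    fix v w
    assume "v \<in> class_words" "w \<in> class_words" "conj_class G4 (g4_elem v) = conj_class G4 (g4_elem w)"
    then show "v = w"
      using conj_class_eq_imp_tr [of "gword_of v" "gword_of w"]
      by (auto simp: g4_elem_eq class_words_def gword_of_def)
  qed
  have "conj_class G4 (g4_class u) \<in> (\<lambda>w. conj_class G4 (g4_elem w)) ` class_words" for u
  proof -
    obtain i where i: "abs_g4 u = g4_word (word_of i)"
      using g4_normal_form [of u] by auto
    obtain h m where "m \<in> class_words" "g4_word h * g4_word (word_of i) = g4_word m * g4_word h"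
      using g4_conj_class_rep [of i] unfolding class_words_def by blast
    then show ?thesis
      using conj_class_eqI [of "gword_of h" u "gword_of m"] i
      by (auto simp: g4_word_def g4_elem_eq)
  qed
  then show "(\<lambda>w. conj_class G4 (g4_elem w)) ` class_words = conj_class G4 ` carrier G4"
    by (auto simp: carrier_G4 g4_elem_eq)
qed

text \<open>Unrolls a bounded quantifier, so that the simplifier enumerates all shorter words, 63 of
  them for \<open>ststst\<close>.\<close>

lemma all_short_lists:
  fixes P :: "gen list \<Rightarrow> bool"
  shows "(\<forall>v. length v < Suc n \<longrightarrow> P v) \<longleftrightarrow>
    P [] \<and> (\<forall>v. length v < n \<longrightarrow> P (S # v)) \<and> (\<forall>v. length v < n \<longrightarrow> P (T # v))"
proof (intro iffI conjI allI impI)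
  fix v :: "gen list"
  assume *: "P [] \<and> (\<forall>v. length v < n \<longrightarrow> P (S # v)) \<and> (\<forall>v. length v < n \<longrightarrow> P (T # v))"
    and "length v < Suc n"
  then show "P v"
    by (cases v; cases "hd v") auto
qed auto

text \<open>The trace is an invariant of the group element, so a trace that no shorter word attains
  certifies minimal length.\<close>

lemma reducedI:
  assumes "\<forall>v. length v < length w \<longrightarrow> mat_tr (mat_rep (gword_of v)) \<noteq> mat_tr (mat_rep (gword_of w))"
  shows "reduced w"
  unfolding reduced_def
proof (intro allI impI)
  fix v assume "g4_elem v = g4_elem w"
  then have "mat_rep (gword_of v) = mat_rep (gword_of w)"
    by (simp add: g4_elem_eq g4_class_eq_iff g4.abs_eq_iff mat_rep_eq)
  then show "length w \<le> length v" using assms by (metis not_le_imp_less)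
qed

lemma reduced_class_words: "w \<in> class_words \<Longrightarrow> reduced w"
  unfolding class_words_def
  by (elim insertE emptyE; hypsubst; rule reducedI)
    (simp_all add: all_short_lists gword_of_def)


section \<open>Distinguished set\<close>

lemma hecke_comb_centre_iff:
  "hecke_comb r \<in> hecke_centre \<longleftrightarrow> (\<forall>i. r (word_of i) = class_extend (r \<circ> word_of) i)"
  by (simp add: hecke_comb_eq comb_centre_iff_class_extend fun_eq_iff)

lemma class_words_eq: "class_words = word_of ` class_reps"
  by (simp add: class_words_def class_reps_def)

lemma distinguished_class_words: "distinguished_set class_words"
proof -
  \<comment> \<open>The matrix of \<open>class_extend\<close>, moved from indices to words; only its
    values at basis words matter.\<close>
  define c where
    "c g w = class_extend (unit_vec (the_inv word_of w)) (the_inv word_of g)" for g w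
  have c: "(\<Sum>w\<in>class_words. c (word_of j) w * r w) = class_extend (r \<circ> word_of) j" for r j
    by (simp add: class_words_eq sum.reindex [OF inj_on_subset [OF inj_word_of subset_UNIV]]
        c_def the_inv_f_f [OF inj_word_of] class_extend_expand [of "r \<circ> word_of"])
  have "hecke_comb r \<in> hecke_centre \<longleftrightarrow> (\<forall>g\<in>B_sts. r g = (\<Sum>w\<in>class_words. c g w * r w))" for r
    by (simp add: hecke_comb_centre_iff B_sts_eq c)
  moreover have "class_words \<subseteq> B_sts"
    by (auto simp: class_words_eq B_sts_eq)
  ultimately show ?thesis
    unfolding distinguished_set_def using reduced_class_words bij_betw_conj_classes by blast
qed

theorem theorem3p8:
  shows "(\<forall>h r. h = hecke_comb r \<longrightarrow>
      (h \<in> hecke_centre \<longleftrightarrow>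
        \<comment> \<open>C1\<close>
        r [S,S,T] = r [T,S,S] \<and>
        r [T,S,S] = (1 + \<xi>\<^sub>1 * \<xi>\<^sub>2) * r [T,T,S] + \<xi>\<^sub>1 * r [S,S] + \<xi>\<^sub>1 * (\<xi>\<^sub>1 + \<xi>\<^sub>2^2) * r [T,T,S,S] \<and>
        \<comment> \<open>C2\<close>
        r [S,T,S] = r [T,T,S] + \<xi>\<^sub>1 * r [T,S] + \<xi>\<^sub>1^2 * r [T,T,S,S] + \<xi>\<^sub>1 * r [S,S] - \<xi>\<^sub>2 * r [S] \<and>
        \<comment> \<open>C3\<close>
        r [T] = r [S] + \<xi>\<^sub>1 * r [T,T,S] + \<xi>\<^sub>1 * \<xi>\<^sub>2 * r [T,T,S,S] \<and>
        \<comment> \<open>C4\<close>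
        r [S,S,T,S] = r [S,T,S,S] \<and>
        r [S,T,S,S] = r [S] + \<xi>\<^sub>1 * (2 + \<xi>\<^sub>1 * \<xi>\<^sub>2) * r [T,T,S] + \<xi>\<^sub>1^2 * r [S,S]
                      + \<xi>\<^sub>1 * (\<xi>\<^sub>2 + \<xi>\<^sub>1 * \<xi>\<^sub>2^2 + \<xi>\<^sub>1^2) * r [T,T,S,S] \<and>
        \<comment> \<open>C5, corrected: the source has \<open>- \<xi>\<^sub>2 r\<^sub>t\<close> (rewritten by C3) in place of \<open>- \<xi>\<^sub>2 r\<^sub>t\<^sub>t\<close>\<close>
        r [S,T,T,S] = r [T,T,S,S] + \<xi>\<^sub>1 * r [T,T,S] - \<xi>\<^sub>2 * r [S,S] \<and>
        \<comment> \<open>C6\<close>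
        r [T,S,S,T] = (1 + 2 * \<xi>\<^sub>1 * \<xi>\<^sub>2 + \<xi>\<^sub>2^3) * r [T,T,S,S] + \<xi>\<^sub>2 * r [S,S]
                      + (\<xi>\<^sub>1 + \<xi>\<^sub>2^2) * r [T,T,S] \<and>
        \<comment> \<open>C7\<close>
        r [S,S,T,S,S] = r [T,S] + \<xi>\<^sub>2 * (1 + \<xi>\<^sub>1 * \<xi>\<^sub>2) * r [T,T,S] + \<xi>\<^sub>1 * \<xi>\<^sub>2 * r [S,S]
                        + \<xi>\<^sub>1 * \<xi>\<^sub>2 * (\<xi>\<^sub>1 + \<xi>\<^sub>2^2) * r [T,T,S,S] \<and>
        \<comment> \<open>C8\<close>
        r [T,T,S,T,T] = r [T,S] + \<xi>\<^sub>2 * (2 + \<xi>\<^sub>1 * \<xi>\<^sub>2) * r [T,T,S] + \<xi>\<^sub>1 * \<xi>\<^sub>2 * r [S,S]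
                        + \<xi>\<^sub>2 * (\<xi>\<^sub>2 + \<xi>\<^sub>1 * \<xi>\<^sub>2^2 + \<xi>\<^sub>1^2) * r [T,T,S,S] \<and>
        \<comment> \<open>C9\<close>
        r [S,S,T,T,S] = r [S,T,T,S,S] \<and>
        r [S,T,T,S,S] = r [S,S] + \<xi>\<^sub>1 * r [T,T,S,S] \<and>
        \<comment> \<open>C10\<close>
        r [T,T] = r [S,S] \<and>
        \<comment> \<open>C11\<close>
        r [S,S,T,T,S,S] = r [T,T,S] + \<xi>\<^sub>2 * r [T,T,S,S] \<and>
        \<comment> \<open>C12\<close>
        r [S,T] = r [T,S] \<and>
        \<comment> \<open>C13\<close>
        r [S,T,T] = r [T,T,S] \<and>
        \<comment> \<open>C14\<close>
        r [S,S,T,T] = r [T,T,S,S])) \<and>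
    distinguished_set {[], [S], [S,S], [T,S], [T,T,S], [T,T,S,S], [S,T,S,T,S,T]} \<and>
    (\<exists>B. is_R_basis B hecke_centre)"
proof (intro conjI allI impI)
  show "distinguished_set {[], [S], [S,S], [T,S], [T,T,S], [T,T,S,S], [S,T,S,T,S,T]}"
    using distinguished_class_words by (simp only: class_words_def)
  show "\<exists>B. is_R_basis B hecke_centre"
    using is_R_basis_class_basis by blast
\<comment> \<open>The 24 coordinate equations are trivial at the seven representatives; elsewhere
  they are the stated relations, up to splitting chained equalities.\<close>
qed (hypsubst, unfold hecke_comb_centre_iff all_ix comp_def word_of.simps class_extend.simps,
  intro iffI conjI; elim conjE; simp only: simp_thms)

end
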